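(* Suppose that problem (P) of the context has an optimal solution and that Slater's condition holds, i.e. there exist $\bm x_i\in\mathrm{ri}(\mathrm{dom}(h_i))$, $i=1,\dots,n$, with $\sum_{i=1}^{n-1}\mathcal A_i\bm x_i+\bm x_n=\bm b$. Let $(\tilde{\bm x},\tilde{\bm z})$ be any optimal solution pair of (P), and suppose that the functions $h_i$, $i=1,\dots,n$, are $C^p$-partly smooth, $p\ge2$ (in the sense specified in the context). If strict complementarity is satisfied at $(\tilde{\bm x},\tilde{\bm z})$, then $F$ is $C^{p-1}$-smooth in a neighborhood of $(\tilde{\bm x},\tilde{\bm z})$.
   Context: Setting. Let $0\le n_1\le n-1$ be integers, $\mathcal I_1=\{1,\dots,n_1\}$, $\mathcal I_2=\{n_1+1,\dots,n\}$. Let $\mathcal X_1,\dots,\mathcal X_n,\mathcal Y$ be finite-dimensional real Euclidean spaces with $\mathcal X_n=\mathcal Y$, let $\mathcal A_i:\mathcal X_i\to\mathcal Y$ be linear for $i=1,\dots,n-1$ (with adjoint $\mathcal A_i^*$), and let $\bm b\in\mathcal Y$. For $i\in\mathcal I_1$, $h_i:\mathcal X_i\to\mathbb R$ is convex and twice continuously differentiable with Lipschitz continuous gradient; for $i\in\mathcal I_2$, $h_i:\mathcal X_i\to(-\infty,+\infty]$ is proper, closed and convex. Problem (P) is $$\min_{\bm x_1,\dots,\bm x_n}\ \sum_{i=1}^n h_i(\bm x_i)\quad\text{s.t.}\quad \sum_{i=1}^{n-1}\mathcal A_i\bm x_i+\bm x_n=\bm b.$$ Notation. $\mathrm{ri}$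 is the relative interior; $e_\sigma h(\bm x)=\min_{\bm y}\{h(\bm y)+\frac\sigma2\|\bm y-\bm x\|^2\}$. Write $\bm x=(\bm x_1,\dots,\bm x_{n-1})$, $\bm z=(\bm z_{n_1+1},\dots,\bm z_n)$ with $\bm z_i\in\mathcal X_i$, $\bm w=(\bm x,\bm z)$. Fix $\sigma>0$ and let $$\Phi(\bm w)=\sum_{i\in\mathcal I_1}h_i(\bm x_i)+\sum_{i\in\mathcal I_2\setminus\{n\}}e_\sigma h_i\Big(\bm x_i-\frac{\bm z_i}\sigma\Big)+e_\sigma h_n\Big(\bm b-\frac{\bm z_n}\sigma-\sum_{i=1}^{n-1}\mathcal A_i\bm x_i\Big)-\frac1{2\sigma}\sum_{i\in\mathcal I_2}\|\bm z_i\|^2,$$ which is continuously differentiable, and $F(\bm w)=(\nabla_{\bm x}\Phi(\bm w),\,-\nabla_{\bm z}\Phi(\bm w))$. Optimal solution pair. $(\tilde{\bm x},\tilde{\bm z})$ is an optimal solution pair of (P) if, with $\tilde{\bm x}_n=\bm b-\sum_{i=1}^{n-1}\mathcal A_i\tilde{\bm x}_i$, the KKT conditions hold: $-\tilde{\bm z}_i\in\partial h_i(\tilde{\bm x}_i)$ for $i\in\mathcal I_2$; $\nabla h_i(\tilde{\bm x}_i)+\mathcal A_i^*\tilde{\bm z}_n=0$ for $i\in\mathcal I_1$; $\mathcal A_i^*\tilde{\bm z}_n-\tilde{\bm z}_i=0$ for $i\in\mathcal I_2\setminus\{n\}$. Strict complementarity (SC) is satisfied at such a pair if $-\tilde{\bm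 z}_i\in\mathrm{ri}(\partial h_i(\tilde{\bm x}_i))$ for all $i\in\mathcal I_2$. Partial smoothness. A proper closed convex $\phi$ is $C^p$-partly smooth ($p\ge2$) at $\bm x\in\mathcal M$ for $\bm v\in\partial\phi(\bm x)$ relative to a $C^p$ embedded submanifold $\mathcal M$ if: (i) $\phi|_{\mathcal M}$ is $C^p$ near $\bm x$; (ii) $\phi$ is prox-regular at $\bm x$ for $\bm v$; (iii) the subspace parallel to $\partial\phi(\bm x)$ equals the normal space $N_{\mathcal M}(\bm x)$; (iv) there is a neighborhood $V$ of $\bm v$ such that the set-valued map $V\cap\partial\phi$ is inner semicontinuous at $\bm x$ relative to $\mathcal M$. The assumption that the $h_i$ are $C^p$-partly smooth means: for each $i$, $h_i$ is $C^p$-partly smooth at $\tilde{\bm x}_i$ relative to some $C^p$ embedded submanifold of $\mathcal X_i$, for the subgradient $-\tilde{\bm z}_i$ if $i\in\mathcal I_2$ and $\nabla h_i(\tilde{\bm x}_i)$ if $i\in\mathcal I_1$. *)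

theory Defs
  imports "HOL-Analysis.Analysis"
begin

(* A finite family of Euclidean spaces of different dimensions is modelled by linear
   subspaces X i of one ambient type 'a::euclidean_space of arbitrary dimension (each finite
   family embeds isometrically into such a type).  Every notion below is therefore relative
   to a subspace X, and the values of functions outside X are irrelevant. *)

section \<open>Calculus on a subspace\<close>

(* U is meant to be relatively open in the subspace X; then the derivative at a point of U is
   unique as a linear map on X. *)
primrec Ck_on :: "nat \<Rightarrow> 'e::real_normed_vector set \<Rightarrow> 'e set \<Rightarrow>
    ('e \<Rightarrow> 'f::real_normed_vector) \<Rightarrow> bool" where
  "Ck_on 0 X U f \<longleftrightarrow> continuous_on U f"
| "Ck_on (Suc k) X U f \<longleftrightarrow>
     (\<exists>f'. (\<forall>x\<in>U. (f has_derivative f' x) (at x within U)) \<and>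
           (\<forall>v\<in>X. Ck_on k X U (\<lambda>x. f' x v)))"

definition grad_on :: "'e::real_inner set \<Rightarrow> ('e \<Rightarrow> real) \<Rightarrow> 'e \<Rightarrow> 'e" where
  "grad_on X f x =
     (THE g. g \<in> X \<and> (f has_derivative (\<lambda>v. inner g v)) (at x within X))"

(* The adjoint of the restriction of A to a map from X to Y. *)
definition adjoint_on :: "'a::real_inner set \<Rightarrow> ('a \<Rightarrow> 'b::real_inner) \<Rightarrow> 'b \<Rightarrow> 'a" where
  "adjoint_on X A y = (THE u. u \<in> X \<and> (\<forall>x\<in>X. inner (A x) y = inner x u))"


section \<open>Extended-real-valued convex functions on a subspace\<close>

definition proper_closed_convex :: "'a::euclidean_space set \<Rightarrow> ('a \<Rightarrow> ereal) \<Rightarrow> bool" where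
  "proper_closed_convex X h \<longleftrightarrow>
     (\<forall>x\<in>X. h x \<noteq> -\<infinity>) \<and> (\<exists>x\<in>X. h x \<noteq> \<infinity>) \<and>
     closed {(x, t). x \<in> X \<and> h x \<le> ereal t} \<and>
     convex {(x, t). x \<in> X \<and> h x \<le> ereal t}"

definition effdom :: "'a set \<Rightarrow> ('a \<Rightarrow> ereal) \<Rightarrow> 'a set" where
  "effdom X h = {x \<in> X. h x < \<infinity>}"

definition subdiff :: "'a::real_inner set \<Rightarrow> ('a \<Rightarrow> ereal) \<Rightarrow> 'a \<Rightarrow> 'a set" where
  "subdiff X h x =
     {v \<in> X. x \<in> X \<and> \<bar>h x\<bar> \<noteq> \<infinity> \<and> (\<forall>y\<in>X. h y \<ge> h x + ereal (inner v (y - x)))}"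

(* For a proper closed convex h the infimum is a finite minimum. *)
definition moreau_env :: "real \<Rightarrow> 'a::real_inner set \<Rightarrow> ('a \<Rightarrow> ereal) \<Rightarrow> 'a \<Rightarrow> real" where
  "moreau_env \<sigma> X h x =
     real_of_ereal (INF y\<in>X. h y + ereal (\<sigma> / 2 * (norm (y - x))\<^sup>2))"


section \<open>Partial smoothness\<close>

(* Local description by defining functions whose differential is onto.  The values of G lie
   in a subspace Z of the ambient space, which stands for R^m with m the codimension of M. *)
definition embedded_submanifold :: "nat \<Rightarrow> 'a::euclidean_space set \<Rightarrow> 'a set \<Rightarrow> bool" where
  "embedded_submanifold p X M \<longleftrightarrow>
     M \<subseteq> X \<and>
     (\<forall>x\<in>M. \<exists>U Z (G :: 'a \<Rightarrow> 'a).
        openin (top_of_set X) U \<and> x \<in> U \<and> subspace Z \<and> G ` U \<subseteq> Z \<and>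
        Ck_on p X U G \<and> M \<inter> U = {y \<in> U. G y = 0} \<and>
        (\<forall>y\<in>U. \<exists>G'. (G has_derivative G') (at y within U) \<and> G' ` X = Z))"

definition tangent_space :: "'a::euclidean_space set \<Rightarrow> 'a \<Rightarrow> 'a set" where
  "tangent_space M x =
     {v. \<exists>c \<epsilon>. \<epsilon> > 0 \<and> c ` {-\<epsilon><..<\<epsilon>} \<subseteq> M \<and> c 0 = x \<and>
           c C1_differentiable_on {-\<epsilon><..<\<epsilon>} \<and> (c has_vector_derivative v) (at 0)}"

definition normal_space :: "'a::euclidean_space set \<Rightarrow> 'a set \<Rightarrow> 'a \<Rightarrow> 'a set" where
  "normal_space X M x = X \<inter> orthogonal_comp (tangent_space M x)"

(* Prox-regularity of a convex function; the limiting subdifferential of the general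
   definition is then the convex one.  Local lower semicontinuity is not repeated here, since
   the definition is only used for proper closed convex functions. *)
definition prox_regular :: "'a::euclidean_space set \<Rightarrow> ('a \<Rightarrow> ereal) \<Rightarrow> 'a \<Rightarrow> 'a \<Rightarrow> bool" where
  "prox_regular X \<phi> x v \<longleftrightarrow>
     v \<in> subdiff X \<phi> x \<and>
     (\<exists>\<epsilon>>0. \<exists>\<rho>\<ge>0. \<forall>x1\<in>X. \<forall>x2\<in>X. \<forall>v1\<in>subdiff X \<phi> x1.
        dist x1 x < \<epsilon> \<and> dist x2 x < \<epsilon> \<and> dist v1 v < \<epsilon> \<and> \<phi> x1 < \<phi> x + ereal \<epsilon> \<longrightarrow>
        \<phi> x2 \<ge> \<phi> x1 + ereal (inner v1 (x2 - x1) - \<rho> / 2 * (norm (x2 - x1))\<^sup>2))"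

definition inner_semicontinuous_at ::
    "('a::metric_space \<Rightarrow> 'b::metric_space set) \<Rightarrow> 'a \<Rightarrow> 'a set \<Rightarrow> bool" where
  "inner_semicontinuous_at S x M \<longleftrightarrow>
     (\<forall>u\<in>S x. \<forall>\<epsilon>>0. \<forall>\<^sub>F y in at x within M. \<exists>u'\<in>S y. dist u' u < \<epsilon>)"

definition parallel_subspace :: "'a::real_vector set \<Rightarrow> 'a set" where
  "parallel_subspace C = span {u - v | u v. u \<in> C \<and> v \<in> C}"

definition partly_smooth ::
    "nat \<Rightarrow> 'a::euclidean_space set \<Rightarrow> ('a \<Rightarrow> ereal) \<Rightarrow> 'a set \<Rightarrow> 'a \<Rightarrow> 'a \<Rightarrow> bool" where
  "partly_smooth p X \<phi> M x v \<longleftrightarrow>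
     proper_closed_convex X \<phi> \<and> embedded_submanifold p X M \<and> x \<in> M \<and> v \<in> subdiff X \<phi> x \<and>
     (\<exists>U g. openin (top_of_set X) U \<and> x \<in> U \<and> Ck_on p X U (g :: 'a \<Rightarrow> real) \<and>
        (\<forall>y\<in>M \<inter> U. \<phi> y = ereal (g y))) \<and>
     prox_regular X \<phi> x v \<and>
     parallel_subspace (subdiff X \<phi> x) = normal_space X M x \<and>
     (\<exists>V. open V \<and> v \<in> V \<and> inner_semicontinuous_at (\<lambda>y. V \<inter> subdiff X \<phi> y) x M)"


section \<open>The optimization problem\<close>

(* The finite type 'n plays the role of the index set {1..n}, the element n :: 'n that of the
   last index; I1 :: 'n set is the first block of indices (n is not in I1) and - I1 the second
   one.  The numbering of the indices is otherwise immaterial. *)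

definition feasible ::
    "('n::finite \<Rightarrow> 'a::euclidean_space set) \<Rightarrow> ('n \<Rightarrow> 'a \<Rightarrow> 'a) \<Rightarrow> 'a \<Rightarrow> 'n \<Rightarrow> ('n \<Rightarrow> 'a) \<Rightarrow> bool"
  where "feasible X A b n x \<longleftrightarrow> (\<forall>i. x i \<in> X i) \<and> (\<Sum>i\<in>-{n}. A i (x i)) + x n = b"

definition optimal_solution ::
    "('n::finite \<Rightarrow> 'a::euclidean_space set) \<Rightarrow> ('n \<Rightarrow> 'a \<Rightarrow> 'a) \<Rightarrow> 'a \<Rightarrow> 'n \<Rightarrow>
     ('n \<Rightarrow> 'a \<Rightarrow> ereal) \<Rightarrow> ('n \<Rightarrow> 'a) \<Rightarrow> bool"
  where "optimal_solution X A b n h x \<longleftrightarrow>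
     feasible X A b n x \<and>
     (\<forall>y. feasible X A b n y \<longrightarrow> (\<Sum>i\<in>UNIV. h i (x i)) \<le> (\<Sum>i\<in>UNIV. h i (y i)))"

(* Tuples (x_1,...,x_{n-1}) and (z_i), i in the second block, are vectors of 'a ^ 'n whose
   unused components are 0, so that norms and inner products are those of the products. *)
definition x_space :: "('n::finite \<Rightarrow> 'a::euclidean_space set) \<Rightarrow> 'n \<Rightarrow> ('a ^ 'n) set" where
  "x_space X n = {x. (\<forall>i\<in>-{n}. x $ i \<in> X i) \<and> x $ n = 0}"

definition z_space :: "('n::finite \<Rightarrow> 'a::euclidean_space set) \<Rightarrow> 'n set \<Rightarrow> ('a ^ 'n) set" where
  "z_space X I1 = {z. (\<forall>i\<in>-I1. z $ i \<in> X i) \<and> (\<forall>i\<in>I1. z $ i = 0)}"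

(* (x_1,...,x_{n-1}) completed by x_n = b - (sum of the A_i x_i) *)
definition full_primal ::
    "('n::finite \<Rightarrow> 'a::euclidean_space \<Rightarrow> 'a) \<Rightarrow> 'a \<Rightarrow> 'n \<Rightarrow> 'a ^ 'n \<Rightarrow> 'n \<Rightarrow> 'a" where
  "full_primal A b n x i = (if i = n then b - (\<Sum>j\<in>-{n}. A j (x $ j)) else x $ i)"

definition optimal_pair ::
    "('n::finite \<Rightarrow> 'a::euclidean_space set) \<Rightarrow> ('n \<Rightarrow> 'a \<Rightarrow> 'a) \<Rightarrow> 'a \<Rightarrow> 'n \<Rightarrow> 'n set \<Rightarrow>
     ('n \<Rightarrow> 'a \<Rightarrow> ereal) \<Rightarrow> 'a ^ 'n \<Rightarrow> 'a ^ 'n \<Rightarrow> bool"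
  where "optimal_pair X A b n I1 h x z \<longleftrightarrow>
     x \<in> x_space X n \<and> z \<in> z_space X I1 \<and>
     (\<forall>i\<in>-I1. - (z $ i) \<in> subdiff (X i) (h i) (full_primal A b n x i)) \<and>
     (\<forall>i\<in>I1. grad_on (X i) (\<lambda>y. real_of_ereal (h i y)) (x $ i)
                + adjoint_on (X i) (A i) (z $ n) = 0) \<and>
     (\<forall>i\<in>-I1 - {n}. adjoint_on (X i) (A i) (z $ n) - z $ i = 0)"

definition strict_complementarity ::
    "('n::finite \<Rightarrow> 'a::euclidean_space set) \<Rightarrow> ('n \<Rightarrow> 'a \<Rightarrow> 'a) \<Rightarrow> 'a \<Rightarrow> 'n \<Rightarrow> 'n set \<Rightarrow>
     ('n \<Rightarrow> 'a \<Rightarrow> ereal) \<Rightarrow> 'a ^ 'n \<Rightarrow> 'a ^ 'n \<Rightarrow> bool"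
  where "strict_complementarity X A b n I1 h x z \<longleftrightarrow>
     (\<forall>i\<in>-I1. - (z $ i) \<in> rel_interior (subdiff (X i) (h i) (full_primal A b n x i)))"

definition Phi ::
    "('n::finite \<Rightarrow> 'a::euclidean_space set) \<Rightarrow> ('n \<Rightarrow> 'a \<Rightarrow> 'a) \<Rightarrow> 'a \<Rightarrow> 'n \<Rightarrow> 'n set \<Rightarrow>
     ('n \<Rightarrow> 'a \<Rightarrow> ereal) \<Rightarrow> real \<Rightarrow> 'a ^ 'n \<Rightarrow> 'a ^ 'n \<Rightarrow> real"
  where "Phi X A b n I1 h \<sigma> x z =
     (\<Sum>i\<in>I1. real_of_ereal (h i (x $ i)))
     + (\<Sum>i\<in>-I1 - {n}. moreau_env \<sigma> (X i) (h i) (x $ i - (z $ i) /\<^sub>R \<sigma>))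
     + moreau_env \<sigma> (X n) (h n) (b - (z $ n) /\<^sub>R \<sigma> - (\<Sum>i\<in>-{n}. A i (x $ i)))
     - 1 / (2 * \<sigma>) * (\<Sum>i\<in>-I1. (norm (z $ i))\<^sup>2)"

definition F_map ::
    "('n::finite \<Rightarrow> 'a::euclidean_space set) \<Rightarrow> ('n \<Rightarrow> 'a \<Rightarrow> 'a) \<Rightarrow> 'a \<Rightarrow> 'n \<Rightarrow> 'n set \<Rightarrow>
     ('n \<Rightarrow> 'a \<Rightarrow> ereal) \<Rightarrow> real \<Rightarrow> ('a ^ 'n) \<times> ('a ^ 'n) \<Rightarrow> ('a ^ 'n) \<times> ('a ^ 'n)"
  where "F_map X A b n I1 h \<sigma> = (\<lambda>(x, z).
     (grad_on (x_space X n) (\<lambda>x'. Phi X A b n I1 h \<sigma> x' z) x,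
      - grad_on (z_space X I1) (\<lambda>z'. Phi X A b n I1 h \<sigma> x z') z))"

end

theory Submission
  imports Defs
begin

text \<open>
  The idea is that \<open>\<Phi>\<close> is \<open>C\<^sup>p\<close> near the optimal pair; the components of \<open>F\<close> are its
  partial gradients.  For an index of the first block the subdifferential is a singleton, so the
  normal space of the manifold vanishes, the manifold is open, and \<open>h\<^sub>i\<close> itself is \<open>C\<^sup>p\<close>.
  For an index of the second block, the gradient of the Moreau envelope at \<open>u\<close> is
  \<open>\<sigma> (u - prox u)\<close>, so that the proximal map has to be \<open>C\<^sup>p\<^sup>-\<^sup>1\<close> near
  \<open>u\<^sub>0 = x\<^sub>0 + v\<^sub>0 / \<sigma>\<close>, where \<open>v\<^sub>0\<close> is a relative interior subgradient at \<open>x\<^sub>0\<close>.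

  Near \<open>u\<^sub>0\<close> the proximal map takes values in the manifold.  Otherwise some \<open>y = prox u\<close> with
  \<open>u\<close> close to \<open>u\<^sub>0\<close> differs from a manifold point \<open>m\<close> by a normal vector of direction nearly
  \<open>e\<close>; since \<open>v\<^sub>0 + \<delta> e\<close> is a subgradient at \<open>x\<^sub>0\<close> for small \<open>\<delta> > 0\<close>, inner semicontinuity
  provides a subgradient at \<open>m\<close> close to it, which contradicts monotonicity along \<open>y - m\<close>.

  The manifold is locally the graph \<open>\<Xi>\<close> of a \<open>C\<^sup>p\<close> map over its tangent space, and the coordinate
  \<open>t\<close> of \<open>prox u\<close> minimizes \<open>h (\<Xi> t) + \<sigma>/2 |\<Xi> t - u|\<^sup>2\<close>.  The quadratic growth of this
  function at its minimizer makes its Hessian nonsingular, so the stationarity equation determines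
  \<open>t\<close> as a \<open>C\<^sup>p\<^sup>-\<^sup>1\<close> function of \<open>u\<close>.
\<close>

section \<open>Orthogonal projections\<close>

definition onb :: "'a::euclidean_space set \<Rightarrow> 'a set" where
  "onb S = (SOME B. B \<subseteq> S \<and> pairwise orthogonal B \<and> (\<forall>x\<in>B. norm x = 1) \<and> finite B \<and> span B = S)"

definition oproj :: "'a::euclidean_space set \<Rightarrow> 'a \<Rightarrow> 'a" where
  "oproj S x = (\<Sum>e\<in>onb S. (x \<bullet> e) *\<^sub>R e)"

lemma
  assumes "subspace S"
  shows onb_subset: "onb S \<subseteq> S" and onb_orthogonal: "pairwise orthogonal (onb S)"
    and norm_onb: "\<And>e. e \<in> onb S \<Longrightarrow> norm e = 1" and finite_onb: "finite (onb S)"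
    and span_onb: "span (onb S) = S"
proof -
  have "\<exists>B. B \<subseteq> S \<and> pairwise orthogonal B \<and> (\<forall>x\<in>B. norm x = 1) \<and> finite B \<and> span B = S"
    by (metis assms orthonormal_basis_subspace independent_imp_finite)
  from someI_ex[OF this, folded onb_def]
  show "onb S \<subseteq> S" "pairwise orthogonal (onb S)" "\<And>e. e \<in> onb S \<Longrightarrow> norm e = 1"
    "finite (onb S)" "span (onb S) = S" by auto
qed

lemma linear_oproj: "linear (oproj S)"
  unfolding oproj_def
  by (intro linearI) (simp_all add: inner_add_left scaleR_add_left sum.distrib scaleR_sum_right)

lemma bounded_linear_oproj: "bounded_linear (oproj S)"
  by (simp add: linear_oproj linear_conv_bounded_linear [symmetric])

lemma oproj_in: "subspace S \<Longrightarrow> oproj S x \<in> S"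
  unfolding oproj_def using onb_subset by (auto intro!: subspace_sum subspace_scale)

lemma oproj_inner_onb:
  assumes "subspace S" "e \<in> onb S"
  shows "oproj S x \<bullet> e = x \<bullet> e"
proof -
  have "oproj S x \<bullet> e = (\<Sum>f\<in>onb S. (x \<bullet> f) * (f \<bullet> e))"
    by (simp add: oproj_def inner_sum_left)
  also have "\<dots> = (\<Sum>f\<in>onb S. if f = e then x \<bullet> e else 0)"
  proof (rule sum.cong[OF refl])
    fix f assume "f \<in> onb S"
    then show "(x \<bullet> f) * (f \<bullet> e) = (if f = e then x \<bullet> e else 0)"
      using onb_orthogonal[OF assms(1)] norm_onb[OF assms(1), of e] assms(2)
      by (auto simp: pairwise_def orthogonal_def norm_eq_1)
  qed
  also have "\<dots> = x \<bullet> e"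
    using assms(2) finite_onb[OF assms(1)] by simp
  finally show ?thesis .
qed

lemma oproj_inner:
  assumes "subspace S" "v \<in> S"
  shows "oproj S x \<bullet> v = x \<bullet> v"
proof -
  have "v \<in> span (onb S)" using assms span_onb by auto
  then have "(x - oproj S x) \<bullet> v = 0"
    by (induction rule: span_induct_alt)
      (auto simp: inner_add_right inner_diff_left oproj_inner_onb[OF assms(1)])
  then show ?thesis by (simp add: inner_diff_left)
qed

lemma oproj_unique:
  assumes "subspace S" "y \<in> S" "\<And>v. v \<in> S \<Longrightarrow> x \<bullet> v = y \<bullet> v"
  shows "oproj S x = y"
proof -
  have "oproj S x - y \<in> S" using assms oproj_in subspace_diff by blast
  then have "(oproj S x - y) \<bullet> (oproj S x - y) = 0"
    using oproj_inner[OF assms(1)] assms(3) by (simp add: inner_diff_left)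
  then show ?thesis by simp
qed

lemma oproj_id: "subspace S \<Longrightarrow> x \<in> S \<Longrightarrow> oproj S x = x"
  by (rule oproj_unique) auto

lemma norm_oproj_le: assumes "subspace S" shows "norm (oproj S x) \<le> norm x"
proof -
  have "oproj S x \<bullet> oproj S x = x \<bullet> oproj S x"
    using oproj_inner[OF assms oproj_in[OF assms]] by simp
  also have "\<dots> \<le> norm x * norm (oproj S x)" by (rule norm_cauchy_schwarz)
  finally have "norm (oproj S x) * norm (oproj S x) \<le> norm x * norm (oproj S x)"
    by (simp add: power2_norm_eq_inner[symmetric] power2_eq_square)
  then show ?thesis
    by (cases "norm (oproj S x) = 0") (auto simp: mult_le_cancel_right)
qed

lemma linear_onb_expand:
  assumes "subspace S" "linear f" "x \<in> S"
  shows "f x = (\<Sum>e\<in>onb S. (x \<bullet> e) *\<^sub>R f e)"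
proof -
  have "f x = f (oproj S x)" using assms oproj_id by metis
  also have "\<dots> = (\<Sum>e\<in>onb S. (x \<bullet> e) *\<^sub>R f e)"
    unfolding oproj_def using assms(2) by (simp add: linear_sum linear_scale o_def)
  finally show ?thesis .
qed


section \<open>Derivatives relative to a subspace\<close>

lemma openin_segment:
  fixes X :: "'a::real_normed_vector set"
  assumes "openin (top_of_set X) U" "subspace X" "x \<in> U" "v \<in> X"
  obtains d where "d > 0" "\<And>r. \<bar>r\<bar> < d \<Longrightarrow> x + r *\<^sub>R v \<in> U"
proof -
  obtain S where S: "open S" "U = X \<inter> S"
    using assms(1) by (meson openin_open)
  have "continuous (at 0) (\<lambda>r. x + r *\<^sub>R v)" by (intro continuous_intros)
  then have "\<forall>\<^sub>F r in nhds 0. x + r *\<^sub>R v \<in> S"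
    using S assms(3) by (simp add: continuous_at_open eventually_nhds)
  then obtain d where "d > 0" "\<forall>r. dist r 0 < d \<longrightarrow> x + r *\<^sub>R v \<in> S"
    by (auto simp: eventually_nhds_metric)
  then show ?thesis
    using S assms by (intro that[of d]) (auto intro!: subspace_add subspace_scale)
qed

lemma has_derivative_directional:
  fixes X :: "'a::real_normed_vector set"
  assumes "(f has_derivative f') (at x within U)"
    and "openin (top_of_set X) U" "subspace X" "x \<in> U" "v \<in> X"
  shows "((\<lambda>r. f (x + r *\<^sub>R v)) has_vector_derivative f' v) (at 0)"
proof -
  obtain d where d: "d > 0" "\<And>r. \<bar>r\<bar> < d \<Longrightarrow> x + r *\<^sub>R v \<in> U"
    using openin_segment[OF assms(2-)] by metis
  interpret f': bounded_linear f' using assms(1) by (rule has_derivative_bounded_linear)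
  have "((\<lambda>r. f (x + r *\<^sub>R v)) has_derivative (\<lambda>r. f' (r *\<^sub>R v))) (at 0 within ball 0 d)"
  proof (rule has_derivative_in_compose[where f = "\<lambda>r. x + r *\<^sub>R v" and g = f and g' = f'])
    show "((\<lambda>r. x + r *\<^sub>R v) has_derivative (\<lambda>r. r *\<^sub>R v)) (at 0 within ball 0 d)"
      by (auto intro!: derivative_eq_intros)
    show "(f has_derivative f') (at (x + 0 *\<^sub>R v) within (\<lambda>r. x + r *\<^sub>R v) ` ball 0 d)"
      using assms(1) by simp (rule has_derivative_subset, use d in \<open>auto simp: dist_norm\<close>)
  qed
  then have "((\<lambda>r. f (x + r *\<^sub>R v)) has_derivative (\<lambda>r. f' (r *\<^sub>R v))) (at 0)"
    using d(1) by (simp add: at_within_open[of 0 "ball 0 d"])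
  then show ?thesis by (simp add: has_vector_derivative_def f'.scaleR)
qed

lemma has_derivative_unique_on_subspace:
  fixes X :: "'a::real_normed_vector set"
  assumes "(f has_derivative f') (at x within U)" "(f has_derivative f'') (at x within U)"
    and "openin (top_of_set X) U" "subspace X" "x \<in> U" "v \<in> X"
  shows "f' v = f'' v"
  using assms has_derivative_directional vector_derivative_unique_at by metis

lemma has_derivative_in_subspace:
  fixes f :: "'a::real_normed_vector \<Rightarrow> 'b::euclidean_space"
  assumes "(f has_derivative f') (at x within U)"
    and "openin (top_of_set X) U" "subspace X" "x \<in> U" "v \<in> X" "subspace Y" "f ` U \<subseteq> Y"
  shows "f' v \<in> Y"
proof -
  have "((\<lambda>x. oproj Y (f x)) has_derivative (\<lambda>v. oproj Y (f' v))) (at x within U)"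
    by (rule bounded_linear.has_derivative[OF bounded_linear_oproj assms(1)])
  then have "(f has_derivative (\<lambda>v. oproj Y (f' v))) (at x within U)"
    by (rule has_derivative_transform[rotated 2])
      (use assms(4,7) oproj_id[OF assms(6)] in \<open>auto simp: image_subset_iff\<close>)
  then have "f' v = oproj Y (f' v)"
    using has_derivative_unique_on_subspace[OF assms(1)] assms by metis
  then show ?thesis using oproj_in[OF assms(6)] by metis
qed


section \<open>Calculus of \<open>C\<^sup>k\<close> maps\<close>

lemma Ck_on_cong:
  assumes "\<And>x. x \<in> U \<Longrightarrow> f x = g x"
  shows "Ck_on k X U f \<longleftrightarrow> Ck_on k X U g"
proof (cases k)
  case 0
  then show ?thesis using assms by (simp cong: continuous_on_cong)
next
  case (Suc m)
  have "(f has_derivative f') (at x within U) \<longleftrightarrow> (g has_derivative f') (at x within U)"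
    if "x \<in> U" for f' x
    using that assms by (metis has_derivative_transform)
  then show ?thesis by (simp add: Suc)
qed

lemma Ck_on_subset: "Ck_on k X U f \<Longrightarrow> U' \<subseteq> U \<Longrightarrow> Ck_on k X U' f"
proof (induction k arbitrary: f)
  case 0
  then show ?case using continuous_on_subset by auto
next
  case (Suc k)
  then show ?case by simp (meson has_derivative_subset subsetD)
qed

lemma Ck_on_SucD: "Ck_on (Suc k) X U f \<Longrightarrow> Ck_on k X U f"
proof (induction k arbitrary: f)
  case 0
  then show ?case by (auto intro: has_derivative_continuous_on)
next
  case (Suc k)
  from Suc.prems obtain f' where "\<forall>x\<in>U. (f has_derivative f' x) (at x within U)"
    "\<forall>v\<in>X. Ck_on (Suc k) X U (\<lambda>x. f' x v)" by (auto simp only: Ck_on.simps(2)[of "Suc k"])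
  with Suc.IH show ?case unfolding Ck_on.simps(2)[of k] by blast
qed

lemma Ck_on_continuous: "Ck_on k X U f \<Longrightarrow> continuous_on U f"
  by (induction k) (auto dest: Ck_on_SucD simp del: Ck_on.simps(2))

lemma Ck_on_zero: "Ck_on k X U (\<lambda>x. 0)"
  by (induction k) (auto intro!: exI[of _ "\<lambda>_ _. 0"])

lemma Ck_on_const: "Ck_on k X U (\<lambda>x. c)"
  by (cases k) (auto intro!: exI[of _ "\<lambda>_ _. 0"] Ck_on_zero)

lemma Ck_on_add: "Ck_on k X U f \<Longrightarrow> Ck_on k X U g \<Longrightarrow> Ck_on k X U (\<lambda>x. f x + g x)"
proof (induction k arbitrary: f g)
  case 0
  then show ?case by (auto intro: continuous_on_add)
next
  case (Suc k)
  then obtain f' g' where "\<forall>x\<in>U. (f has_derivative f' x) (at x within U)"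
    "\<forall>v\<in>X. Ck_on k X U (\<lambda>x. f' x v)" "\<forall>x\<in>U. (g has_derivative g' x) (at x within U)"
    "\<forall>v\<in>X. Ck_on k X U (\<lambda>x. g' x v)" by auto
  with Suc.IH show ?case
    by (auto intro!: exI[of _ "\<lambda>x v. f' x v + g' x v"] has_derivative_add)
qed

lemma Ck_on_bounded_linear_compose:
  assumes "bounded_linear L"
  shows "Ck_on k X U f \<Longrightarrow> Ck_on k X U (\<lambda>x. L (f x))"
proof (induction k arbitrary: f)
  case 0
  then show ?case using bounded_linear.continuous_on[OF assms] by auto
next
  case (Suc k)
  then obtain f' where "\<forall>x\<in>U. (f has_derivative f' x) (at x within U)"
    "\<forall>v\<in>X. Ck_on k X U (\<lambda>x. f' x v)" by auto
  with Suc.IH show ?case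
    by (auto intro!: exI[of _ "\<lambda>x v. L (f' x v)"] bounded_linear.has_derivative[OF assms])
qed

lemma Ck_on_bounded_linear: "bounded_linear L \<Longrightarrow> Ck_on k X U L"
  by (cases k)
    (auto intro!: exI[of _ "\<lambda>x. L"] Ck_on_const bounded_linear_imp_has_derivative
      intro: linear_continuous_on)

lemma Ck_on_ident: "Ck_on k X U (\<lambda>x. x)"
  by (rule Ck_on_bounded_linear) (rule bounded_linear_ident)

lemma Ck_on_minus: "Ck_on k X U f \<Longrightarrow> Ck_on k X U (\<lambda>x. - f x)"
  by (rule Ck_on_bounded_linear_compose[OF bounded_linear_minus[OF bounded_linear_ident]])

lemma Ck_on_diff: "Ck_on k X U f \<Longrightarrow> Ck_on k X U g \<Longrightarrow> Ck_on k X U (\<lambda>x. f x - g x)"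
  using Ck_on_add[of k X U f "\<lambda>x. - g x"] Ck_on_minus by auto

lemma Ck_on_sum: "(\<And>i. i \<in> I \<Longrightarrow> Ck_on k X U (f i)) \<Longrightarrow> Ck_on k X U (\<lambda>x. \<Sum>i\<in>I. f i x)"
  by (induction I rule: infinite_finite_induct) (auto intro: Ck_on_zero Ck_on_add)

lemma Ck_on_Pair:
  assumes "Ck_on k X U f" "Ck_on k X U g"
  shows "Ck_on k X U (\<lambda>x. (f x, g x))"
proof -
  have "Ck_on k X U (\<lambda>x. (f x, 0) + (0, g x))"
    by (intro Ck_on_add Ck_on_bounded_linear_compose[OF _ assms(1)]
        Ck_on_bounded_linear_compose[OF _ assms(2)] bounded_linear_Pair
        bounded_linear_ident bounded_linear_zero)
  then show ?thesis by simp
qed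

lemma Ck_on_bilinear:
  assumes "bounded_bilinear pr"
  shows "Ck_on k X U f \<Longrightarrow> Ck_on k X U g \<Longrightarrow> Ck_on k X U (\<lambda>x. pr (f x) (g x))"
proof (induction k arbitrary: f g)
  case 0
  then show ?case using bounded_bilinear.continuous_on[OF assms] by auto
next
  case (Suc k)
  from Suc.prems obtain f' g' where *: "\<forall>x\<in>U. (f has_derivative f' x) (at x within U)"
    "\<forall>v\<in>X. Ck_on k X U (\<lambda>x. f' x v)" "\<forall>x\<in>U. (g has_derivative g' x) (at x within U)"
    "\<forall>v\<in>X. Ck_on k X U (\<lambda>x. g' x v)" by auto
  have "Ck_on k X U f" "Ck_on k X U g" using Suc.prems Ck_on_SucD by blast+
  with * Suc.IH show ?case
    by (auto intro!: exI[of _ "\<lambda>x v. pr (f x) (g' x v) + pr (f' x v) (g x)"]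
        bounded_bilinear.FDERIV[OF assms] Ck_on_add)
qed

lemmas Ck_on_scaleR = Ck_on_bilinear[OF bounded_bilinear_scaleR]
lemmas Ck_on_inner = Ck_on_bilinear[OF bounded_bilinear_inner]

lemma Ck_on_compose:
  fixes f :: "'a::real_normed_vector \<Rightarrow> 'b::euclidean_space"
  assumes "subspace X" "openin (top_of_set X) U" "subspace Y" "f ` U \<subseteq> W" "W \<subseteq> Y"
  shows "Ck_on k X U f \<Longrightarrow> Ck_on k Y W g \<Longrightarrow> Ck_on k X U (\<lambda>x. g (f x))"
proof (induction k arbitrary: g)
  case 0
  then show ?case using assms continuous_on_compose2 by auto
next
  case (Suc k)
  from Suc.prems obtain f' g' where *: "\<forall>x\<in>U. (f has_derivative f' x) (at x within U)"
    "\<forall>v\<in>X. Ck_on k X U (\<lambda>x. f' x v)" "\<forall>y\<in>W. (g has_derivative g' y) (at y within W)"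
    "\<forall>v\<in>Y. Ck_on k Y W (\<lambda>y. g' y v)" by auto
  have f: "Ck_on k X U f" using Suc.prems Ck_on_SucD by blast
  have "Ck_on k X U (\<lambda>x. g' (f x) (f' x v))" if "v \<in> X" for v
  proof -
    have "Ck_on k X U (\<lambda>x. \<Sum>e\<in>onb Y. (f' x v \<bullet> e) *\<^sub>R g' (f x) e)"
      using * that onb_subset[OF assms(3)]
      by (intro Ck_on_sum Ck_on_scaleR Ck_on_inner Ck_on_const Suc.IH[OF f]) auto
    moreover have eq: "g' (f x) (f' x v) = (\<Sum>e\<in>onb Y. (f' x v \<bullet> e) *\<^sub>R g' (f x) e)" if "x \<in> U" for x
    proof (rule linear_onb_expand[OF assms(3)])
      show "linear (g' (f x))"
        using * that assms has_derivative_linear by blast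
      show "f' x v \<in> Y"
        by (rule has_derivative_in_subspace[of f "f' x" x U X v Y])
          (use * \<open>v \<in> X\<close> that assms in auto)
    qed
    then have "Ck_on k X U (\<lambda>x. g' (f x) (f' x v)) \<longleftrightarrow>
        Ck_on k X U (\<lambda>x. \<Sum>e\<in>onb Y. (f' x v \<bullet> e) *\<^sub>R g' (f x) e)"
      by (rule Ck_on_cong)
    ultimately show ?thesis by simp
  qed
  moreover have "((\<lambda>x. g (f x)) has_derivative (\<lambda>v. g' (f x) (f' x v))) (at x within U)" if "x \<in> U" for x
    by (rule has_derivative_in_compose2[of W g g' f U]) (use * that assms(4) in auto)
  ultimately show ?case by (auto intro!: exI[of _ "\<lambda>x v. g' (f x) (f' x v)"])
qed


section \<open>Regularity of implicitly defined maps\<close>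

lemma left_inverse_on:
  fixes f :: "'a::euclidean_space \<Rightarrow> 'b::euclidean_space"
  assumes "linear f" "subspace V" "\<And>v. v \<in> V \<Longrightarrow> f v = 0 \<Longrightarrow> v = 0"
  obtains g where "bounded_linear g" "\<And>c. g c \<in> V" "\<And>v. v \<in> V \<Longrightarrow> g (f v) = v"
proof -
  have "inj_on f V"
    using assms by (metis linear_injective_on_subspace_0)
  then show ?thesis
    using linear_exists_left_inverse_on[OF assms(1,2)] that
    by (metis linear_conv_bounded_linear range_subsetD)
qed

lemma implicit_differentiable:
  fixes s :: "'a::euclidean_space \<Rightarrow> 'b::euclidean_space"
    and K :: "'b \<times> 'a \<Rightarrow> 'c::euclidean_space"
  assumes Y: "subspace Y" "s ` U \<subseteq> Y" and x0: "x0 \<in> U" and cont: "continuous (at x0 within U) s"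
    and W: "\<And>x. x \<in> U \<Longrightarrow> (s x, x) \<in> W" and K0: "\<And>x. x \<in> U \<Longrightarrow> K (s x, x) = 0"
    and D: "(K has_derivative D) (at (s x0, x0) within W)"
    and inj: "\<And>y. y \<in> Y \<Longrightarrow> D (y, 0) = 0 \<Longrightarrow> y = 0"
  shows "\<exists>s'. (s has_derivative s') (at x0 within U)"
proof -
  interpret D: bounded_linear D using D by (rule has_derivative_bounded_linear)
  obtain R where R: "bounded_linear R" "\<And>y. y \<in> Y \<Longrightarrow> R (D (y, 0)) = y"
  proof (rule left_inverse_on[of "\<lambda>y. D (y, 0)" Y])
    show "linear (\<lambda>y. D (y, 0))"
      by (intro linearI) (simp_all add: D.add[symmetric] D.scaleR[symmetric])
  qed (use Y inj in auto)
  interpret R: bounded_linear R by fact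
  obtain B where B: "B > 0" "\<And>c. norm (R c) \<le> norm c * B" using R.pos_bounded by auto
  define s' where "s' = (\<lambda>v. - R (D (0, v)))"
  have bl: "bounded_linear s'"
    unfolding s'_def
    by (intro bounded_linear_minus bounded_linear_compose[OF R(1)]
        bounded_linear_compose[OF D.bounded_linear_axioms] bounded_linear_Pair
        bounded_linear_zero bounded_linear_ident)
  then obtain C where C: "C > 0" "\<And>v. norm (s' v) \<le> norm v * C"
    using bounded_linear.pos_bounded by blast
  have "(s has_derivative s') (at x0 within U)"
    unfolding has_derivative_within_alt2
  proof (intro conjI allI impI bl)
    fix \<epsilon> :: real assume "\<epsilon> > 0"
    define \<eta> where "\<eta> = min (1/2) (\<epsilon> / (2 * C + 2)) / B"
    have "\<eta> > 0" using B C \<open>\<epsilon> > 0\<close> by (simp add: \<eta>_def)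
    moreover have "B * \<eta> = min (1/2) (\<epsilon> / (2 * C + 2))" using B by (simp add: \<eta>_def)
    moreover have "\<epsilon> / (2 * C + 2) * (2 * C + 2) = \<epsilon>" using C by simp
    moreover have "min (1/2) (\<epsilon> / (2 * C + 2)) \<le> 1/2" by (rule min.cobounded1)
    ultimately have \<eta>: "\<eta> > 0" "B * \<eta> \<le> 1/2" "B * \<eta> * (2 * C + 2) \<le> \<epsilon>"
      using C mult_right_mono[of "B * \<eta>" "\<epsilon> / (2 * C + 2)" "2 * C + 2"] by simp_all
    obtain d where d: "d > 0" "\<And>w. w \<in> W \<Longrightarrow> norm (w - (s x0, x0)) < d \<Longrightarrow>
        norm (K w - K (s x0, x0) - D (w - (s x0, x0))) \<le> \<eta> * norm (w - (s x0, x0))"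
      using D[unfolded has_derivative_within_alt, THEN conjunct2, rule_format, OF \<eta>(1)] by blast
    have "((\<lambda>x. (s x, x)) \<longlongrightarrow> (s x0, x0)) (at x0 within U)"
      using cont by (intro tendsto_Pair tendsto_ident_at) (simp add: continuous_within)
    from tendstoD[OF this d(1)]
    have "\<forall>\<^sub>F x in at x0 within U. norm ((s x, x) - (s x0, x0)) < d"
      by (simp add: dist_norm)
    moreover have "\<forall>\<^sub>F x in at x0 within U. x \<in> U" by (simp add: eventually_at_filter)
    ultimately show "\<forall>\<^sub>F x in at x0 within U. norm (s x - s x0 - s' (x - x0)) \<le> \<epsilon> * norm (x - x0)"
    proof eventually_elim
      case x: (elim x)
        define \<Delta> \<delta> where "\<Delta> = s x - s x0" and "\<delta> = x - x0"
        have "\<Delta> \<in> Y" using Y x(2) x0 by (auto simp: \<Delta>_def intro!: subspace_diff)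
        have "\<Delta> - s' \<delta> = R (D (\<Delta>, 0) + D (0, \<delta>))"
          using R(2)[OF \<open>\<Delta> \<in> Y\<close>] by (simp add: s'_def R.add)
        also have "D (\<Delta>, 0) + D (0, \<delta>) = D (\<Delta>, \<delta>)" by (simp add: D.add[symmetric])
        finally have "norm (\<Delta> - s' \<delta>) \<le> norm (D (\<Delta>, \<delta>)) * B" using B by simp
        moreover have "norm (D (\<Delta>, \<delta>)) \<le> \<eta> * norm (\<Delta>, \<delta>)"
          using d(2)[OF W[OF x(2)] x(1)] K0 x x0 by (simp add: \<Delta>_def \<delta>_def)
        moreover have "norm (\<Delta>, \<delta>) \<le> norm \<Delta> + norm \<delta>"
          by (simp add: norm_Pair sqrt_sum_squares_le_sum)
        ultimately have "norm (\<Delta> - s' \<delta>) \<le> \<eta> * (norm \<Delta> + norm \<delta>) * B"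
          by (smt (verit, best) B(1) \<eta>(1) mult_left_mono mult_right_mono)
        then have 1: "norm (\<Delta> - s' \<delta>) \<le> (B * \<eta>) * (norm \<Delta> + norm \<delta>)" by (simp add: mult_ac)
        also have "\<dots> \<le> 1/2 * (norm \<Delta> + norm \<delta>)" by (intro mult_right_mono \<eta>) auto
        finally have "norm \<Delta> - norm \<delta> * C \<le> 1/2 * (norm \<Delta> + norm \<delta>)"
          using C(2)[of \<delta>] norm_triangle_ineq2[of \<Delta> "s' \<delta>"] by linarith
        then have "norm \<Delta> + norm \<delta> \<le> (2 * C + 2) * norm \<delta>" by (simp add: algebra_simps)
        then have "(B * \<eta>) * (norm \<Delta> + norm \<delta>) \<le> (B * \<eta>) * ((2 * C + 2) * norm \<delta>)"
          using B \<eta> by (intro mult_left_mono) auto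
        also have "\<dots> \<le> \<epsilon> * norm \<delta>"
          using mult_right_mono[OF \<eta>(3), of "norm \<delta>"] by (simp add: mult_ac)
        finally show "norm (s x - s x0 - s' (x - x0)) \<le> \<epsilon> * norm (x - x0)"
          using 1 by (simp add: \<Delta>_def \<delta>_def)
    qed
  qed
  then show ?thesis by blast
qed

lemma continuous_on_linear_solve:
  fixes B :: "'a::topological_space \<Rightarrow> 'b::euclidean_space \<Rightarrow> 'c::euclidean_space"
  assumes Y: "subspace Y" and lin: "\<And>x. x \<in> U \<Longrightarrow> linear (B x)"
    and B: "\<And>e. e \<in> Y \<Longrightarrow> continuous_on U (\<lambda>x. B x e)" and r: "continuous_on U r"
    and w: "\<And>x. x \<in> U \<Longrightarrow> w x \<in> Y" "\<And>x. x \<in> U \<Longrightarrow> B x (w x) = r x"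
    and inj: "\<And>x y. x \<in> U \<Longrightarrow> y \<in> Y \<Longrightarrow> B x y = 0 \<Longrightarrow> y = 0"
  shows "continuous_on U w"
  unfolding continuous_on_def
proof
  fix x0 assume x0: "x0 \<in> U"
  obtain R where R: "bounded_linear R" "\<And>y. y \<in> Y \<Longrightarrow> R (B x0 y) = y"
    using left_inverse_on[OF lin[OF x0] Y] inj x0 by metis
  interpret R: bounded_linear R by fact
  obtain b where b: "b > 0" "\<And>c. norm (R c) \<le> norm c * b" using R.pos_bounded by auto
  define \<eta> where "\<eta> = (\<lambda>x. \<Sum>e\<in>onb Y. norm (B x0 e - B x e))"
  have \<eta>0: "(\<eta> \<longlongrightarrow> 0) (at x0 within U)"
  proof -
    have "((\<lambda>x. \<Sum>e\<in>onb Y. norm (B x0 e - B x e)) \<longlongrightarrow> (\<Sum>e\<in>onb Y. norm (B x0 e - B x0 e))) (at x0 within U)"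
      using B onb_subset[OF Y] x0 unfolding continuous_on_def
      by (intro tendsto_intros) blast
    then show ?thesis by (simp add: \<eta>_def)
  qed
  have r0: "((\<lambda>x. norm (r x - r x0)) \<longlongrightarrow> 0) (at x0 within U)"
    using r x0 unfolding continuous_on_def by (simp add: tendsto_norm_zero_iff LIM_zero)
  have bound: "norm (w x - w x0) \<le> 2 * b * (\<eta> x * norm (w x0) + norm (r x - r x0))"
    if x: "x \<in> U" "b * \<eta> x < 1/2" for x
  proof -
    interpret L0: linear "B x0" using lin x0 .
    interpret L: linear "B x" using lin x(1) .
    have "linear (\<lambda>y. B x0 y - B x y)"
      by (intro linear_compose_sub lin x0 x)
    then have "B x0 (w x) - B x (w x) = (\<Sum>e\<in>onb Y. (w x \<bullet> e) *\<^sub>R (B x0 e - B x e))"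
      using linear_onb_expand[OF Y _ w(1)[OF x(1)]] by blast
    also have "norm \<dots> \<le> (\<Sum>e\<in>onb Y. norm (w x) * norm (B x0 e - B x e))"
    proof (rule sum_norm_le)
      fix e assume "e \<in> onb Y"
      then have "\<bar>w x \<bullet> e\<bar> \<le> norm (w x)"
        using norm_onb[OF Y] Cauchy_Schwarz_ineq2[of "w x" e] by simp
      then show "norm ((w x \<bullet> e) *\<^sub>R (B x0 e - B x e)) \<le> norm (w x) * norm (B x0 e - B x e)"
        by (simp add: mult_right_mono)
    qed
    finally have 1: "norm (B x0 (w x) - B x (w x)) \<le> norm (w x) * \<eta> x"
      by (simp add: \<eta>_def sum_distrib_left)
    have "w x - w x0 = R (B x0 (w x - w x0))"
      using R(2) w(1) x x0 Y by (simp add: subspace_diff)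
    also have "B x0 (w x - w x0) = (B x0 (w x) - B x (w x)) + (r x - r x0)"
      using w(2) x x0 by (simp add: L0.diff)
    finally have "norm (w x - w x0) \<le> norm ((B x0 (w x) - B x (w x)) + (r x - r x0)) * b"
      using b(2) by metis
    also have "\<dots> \<le> (norm (w x) * \<eta> x + norm (r x - r x0)) * b"
      using 1 b(1) norm_triangle_ineq[of "B x0 (w x) - B x (w x)" "r x - r x0"]
      by (intro mult_right_mono) auto
    also have "\<dots> = norm (w x) * (b * \<eta> x) + b * norm (r x - r x0)" by (simp add: algebra_simps)
    also have "norm (w x) * (b * \<eta> x) \<le> (norm (w x0) + norm (w x - w x0)) * (b * \<eta> x)"
    proof (intro mult_right_mono)
      show "norm (w x) \<le> norm (w x0) + norm (w x - w x0)"
        using norm_triangle_ineq[of "w x0" "w x - w x0"] by simp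
    qed (use b in \<open>auto simp: \<eta>_def sum_nonneg\<close>)
    also have "\<dots> \<le> b * \<eta> x * norm (w x0) + 1/2 * norm (w x - w x0)"
      using x(2) mult_right_mono[of "b * \<eta> x" "1/2" "norm (w x - w x0)"] by (simp add: algebra_simps)
    finally show ?thesis by (simp add: algebra_simps)
  qed
  have "((\<lambda>x. 2 * b * (\<eta> x * norm (w x0) + norm (r x - r x0))) \<longlongrightarrow> 2 * b * (0 * norm (w x0) + 0)) (at x0 within U)"
    by (intro tendsto_intros \<eta>0 r0)
  then have lim: "((\<lambda>x. 2 * b * (\<eta> x * norm (w x0) + norm (r x - r x0))) \<longlongrightarrow> 0) (at x0 within U)" by simp
  have "((\<lambda>x. b * \<eta> x) \<longlongrightarrow> b * 0) (at x0 within U)" by (intro tendsto_intros \<eta>0)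
  then have "\<forall>\<^sub>F x in at x0 within U. b * \<eta> x < 1/2" by (rule order_tendstoD) simp
  moreover have "\<forall>\<^sub>F x in at x0 within U. x \<in> U" by (simp add: eventually_at_filter)
  ultimately have "\<forall>\<^sub>F x in at x0 within U. norm (w x - w x0) \<le> 2 * b * (\<eta> x * norm (w x0) + norm (r x - r x0))"
    by eventually_elim (rule bound)
  from Lim_null_comparison[OF this lim] show "(w \<longlongrightarrow> w x0) (at x0 within U)"
    by (simp add: LIM_zero_iff)
qed

text \<open>
  The continuous solution \<open>s\<close> is given, so no existence argument is needed: differentiating the
  equation shows that each \<open>s' x v\<close> solves a linear equation with coefficients of class \<open>C\<^sup>k\<close>, and
  that linear equation is again an instance of the statement, one order lower.  The last premise
  quantifies over all derivatives of \<open>K\<close> in order to be vacuous where \<open>K\<close> is not differentiable,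
  which may happen for \<open>k = 0\<close>.
\<close>

lemma Ck_on_implicit:
  fixes s :: "'a::euclidean_space \<Rightarrow> 'b::euclidean_space"
    and K :: "'b \<times> 'a \<Rightarrow> 'c::euclidean_space"
  assumes X: "subspace X" "openin (top_of_set X) U" and Y: "subspace Y"
  shows "\<lbrakk>continuous_on U s; \<And>x. x \<in> U \<Longrightarrow> s x \<in> Y; openin (top_of_set (Y \<times> X)) W;
    \<And>x. x \<in> U \<Longrightarrow> (s x, x) \<in> W; Ck_on k (Y \<times> X) W K; \<And>x. x \<in> U \<Longrightarrow> K (s x, x) = 0;
    \<And>x D y. x \<in> U \<Longrightarrow> (K has_derivative D) (at (s x, x) within W) \<Longrightarrow> y \<in> Y \<Longrightarrow> D (y, 0) = 0 \<Longrightarrow> y = 0\<rbrakk>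
    \<Longrightarrow> Ck_on k X U s"
proof (induction k arbitrary: s K W)
  case 0
  then show ?case by simp
next
  case (Suc k)
  note cont = Suc.prems(1) and sY = Suc.prems(2) and W = Suc.prems(3) and sW = Suc.prems(4)
    and K = Suc.prems(5) and K0 = Suc.prems(6) and inj = Suc.prems(7)
  have YX: "subspace (Y \<times> X)" using X Y by (simp add: subspace_Times)
  have UX: "U \<subseteq> X" using X(2) openin_subset by force
  have WYX: "W \<subseteq> Y \<times> X" using W openin_subset by force
  obtain K' where K': "\<And>w. w \<in> W \<Longrightarrow> (K has_derivative K' w) (at w within W)"
    "\<And>v. v \<in> Y \<times> X \<Longrightarrow> Ck_on k (Y \<times> X) W (\<lambda>w. K' w v)" using K by auto
  have linK': "linear (K' w)" if "w \<in> W" for w using K'(1)[OF that] has_derivative_linear by blast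
  have s: "Ck_on k X U s"
    using Suc.IH[OF cont sY W sW Ck_on_SucD[OF K] K0] inj by blast
  then have graph: "Ck_on k X U (\<lambda>x. (s x, x))" by (intro Ck_on_Pair Ck_on_ident)
  have comp: "Ck_on k X U (\<lambda>x. K' (s x, x) v)" if "v \<in> Y \<times> X" for v
    by (rule Ck_on_compose[OF X YX _ WYX graph K'(2)[OF that]]) (use sW in auto)
  have "\<exists>s'. (s has_derivative s') (at x within U)" if "x \<in> U" for x
    using implicit_differentiable[OF Y _ that _ sW K0 K'(1)[OF sW[OF that]]]
      inj[OF that K'(1)[OF sW[OF that]]] sY cont that
    by (meson continuous_on_eq_continuous_within image_subsetI)
  then obtain s' where s': "\<And>x. x \<in> U \<Longrightarrow> (s has_derivative s' x) (at x within U)" by metis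
  have "Ck_on k X U (\<lambda>x. s' x v)" if v: "v \<in> X" for v
  proof -
    define B where "B = (\<lambda>x y. K' (s x, x) (y, 0))"
    define r where "r = (\<lambda>x. - K' (s x, x) (0, v))"
    define K2 where "K2 = (\<lambda>(y, x). (\<Sum>e\<in>onb Y. (y \<bullet> e) *\<^sub>R B x e) - r x)"
    have linB: "linear (B x)" if "x \<in> U" for x
    proof -
      interpret L: linear "K' (s x, x)" using linK'[OF sW[OF that]] .
      show ?thesis unfolding B_def
        by (intro linearI) (simp_all add: L.add[symmetric] L.scale[symmetric])
    qed
    have Bexp: "(\<Sum>e\<in>onb Y. (y \<bullet> e) *\<^sub>R B x e) = B x y" if "x \<in> U" "y \<in> Y" for x y
      using linear_onb_expand[OF Y linB] that by metis
    have CB: "Ck_on k X U (\<lambda>x. B x e)" if "e \<in> Y" for e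
      unfolding B_def using comp X that by (simp add: subspace_0)
    have Cr: "Ck_on k X U r"
      unfolding r_def using comp Y v by (intro Ck_on_minus) (simp add: subspace_0)
    have injB: "y = 0" if "x \<in> U" "y \<in> Y" "B x y = 0" for x y
      using inj[OF that(1) K'(1)[OF sW[OF that(1)]] that(2)] that(3) by (simp add: B_def)
    have s'Y: "s' x v \<in> Y" if "x \<in> U" for x
      using has_derivative_in_subspace[OF s'[OF that] X(2) X(1) that v Y] sY by blast
    have eq: "B x (s' x v) = r x" if "x \<in> U" for x
    proof -
      interpret L: linear "K' (s x, x)" using linK'[OF sW[OF that]] .
      have "((\<lambda>x. K (s x, x)) has_derivative (\<lambda>v. K' (s x, x) (s' x v, v))) (at x within U)"
        by (rule has_derivative_in_compose2[of W K K', OF K'(1)])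
          (use sW that s'[OF that] in \<open>auto intro!: derivative_intros\<close>)
      moreover have "((\<lambda>x. K (s x, x)) has_derivative (\<lambda>v. 0)) (at x within U)"
        by (rule has_derivative_transform[OF that K0 has_derivative_const])
      ultimately have "K' (s x, x) (s' x v, v) = 0"
        by (rule has_derivative_unique_on_subspace[OF _ _ X(2,1) that v])
      then show ?thesis
        using L.add[of "(s' x v, 0)" "(0, v)"] by (simp add: B_def r_def eq_neg_iff_add_eq_0)
    qed
    have C0: "continuous_on U (\<lambda>x. s' x v)"
      by (rule continuous_on_linear_solve[OF Y linB Ck_on_continuous[OF CB] Ck_on_continuous[OF Cr] s'Y eq injB])
    have W2: "openin (top_of_set (Y \<times> X)) (Y \<times> U)" using X(2) by (simp add: openin_Times)
    have "Ck_on k X U (\<lambda>x. s' x v)"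
    proof (rule Suc.IH[OF C0 s'Y W2, where K = K2])
      show "Ck_on k (Y \<times> X) (Y \<times> U) K2"
        unfolding K2_def case_prod_beta
      proof (intro Ck_on_diff Ck_on_sum Ck_on_scaleR Ck_on_inner Ck_on_const)
        have snd: "Ck_on k (Y \<times> X) (Y \<times> U) snd" "Ck_on k (Y \<times> X) (Y \<times> U) fst"
          by (auto intro!: Ck_on_bounded_linear bounded_linear_fst bounded_linear_snd)
        show "Ck_on k (Y \<times> X) (Y \<times> U) fst" by (rule snd)
        show "Ck_on k (Y \<times> X) (Y \<times> U) (\<lambda>x. r (snd x))"
          by (rule Ck_on_compose[OF YX W2 X(1) _ UX snd(1) Cr]) auto
        show "Ck_on k (Y \<times> X) (Y \<times> U) (\<lambda>x. B (snd x) e)" if "e \<in> onb Y" for e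
          by (rule Ck_on_compose[OF YX W2 X(1) _ UX snd(1) CB]) (use that onb_subset[OF Y] in auto)
      qed
      show "K2 (s' x v, x) = 0" if "x \<in> U" for x
        using Bexp[OF that s'Y[OF that]] eq[OF that] by (simp add: K2_def)
      fix x D y
      assume x: "x \<in> U" and y: "y \<in> Y" and D0: "D (y, 0) = 0"
        and D: "(K2 has_derivative D) (at (s' x v, x) within Y \<times> U)"
      have "((\<lambda>t. K2 ((s' x v, x) + t *\<^sub>R (y, 0))) has_vector_derivative D (y, 0)) (at 0)"
        by (rule has_derivative_directional[OF D W2 YX]) (use x y s'Y X subspace_0 in auto)
      moreover have "K2 ((s' x v, x) + t *\<^sub>R (y, 0)) = (B x (s' x v) - r x) + t *\<^sub>R B x y" for t
      proof -
        interpret L: linear "B x" using linB[OF x] .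
        have "s' x v + t *\<^sub>R y \<in> Y" using Y y s'Y[OF x] by (simp add: subspace_add subspace_scale)
        then show ?thesis using Bexp[OF x] by (simp add: K2_def L.add L.scale)
      qed
      moreover have "((\<lambda>t. (B x (s' x v) - r x) + t *\<^sub>R B x y) has_vector_derivative B x y) (at 0)"
        by (auto intro!: derivative_eq_intros)
      ultimately have "B x y = 0" using D0 vector_derivative_unique_at by fastforce
      then show "y = 0" using injB x y by blast
    qed (use s'Y in auto)
    then show ?thesis .
  qed
  then show ?case using s' by auto
qed


section \<open>The proximal map and the Moreau envelope\<close>

lemma subdiff_real:
  assumes "v \<in> subdiff X h x"
  shows "h x = ereal (real_of_ereal (h x))" "x \<in> X" "v \<in> X"
  using assms by (auto simp: subdiff_def ereal_real')

lemma subdiff_ineq: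
  assumes "v \<in> subdiff X h x" "y \<in> X" "h y = ereal t"
  shows "t \<ge> real_of_ereal (h x) + v \<bullet> (y - x)"
proof -
  have "h y \<ge> h x + ereal (v \<bullet> (y - x))" using assms by (auto simp: subdiff_def)
  then have "ereal t \<ge> ereal (real_of_ereal (h x)) + ereal (v \<bullet> (y - x))"
    using subdiff_real(1)[OF assms(1)] assms(3) by simp
  then show ?thesis by simp
qed

lemma subdiff_monotone:
  assumes "v \<in> subdiff X h x" "w \<in> subdiff X h y"
  shows "(v - w) \<bullet> (x - y) \<ge> 0"
proof -
  note x = subdiff_real[OF assms(1)] and y = subdiff_real[OF assms(2)]
  have "real_of_ereal (h y) \<ge> real_of_ereal (h x) + v \<bullet> (y - x)"
    "real_of_ereal (h x) \<ge> real_of_ereal (h y) + w \<bullet> (x - y)"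
    using subdiff_ineq[OF assms(1) y(2,1)] subdiff_ineq[OF assms(2) x(2,1)] by auto
  then show ?thesis by (simp add: inner_diff_left inner_diff_right)
qed

lemma norm_sq_shift:
  fixes a b u :: "'a::real_inner"
  shows "(norm (b - u))\<^sup>2 = (norm (a - u))\<^sup>2 + 2 * ((a - u) \<bullet> (b - a)) + (norm (b - a))\<^sup>2"
  by (simp add: power2_norm_eq_inner inner_diff_left inner_diff_right inner_commute)

definition prox :: "real \<Rightarrow> 'a::euclidean_space set \<Rightarrow> ('a \<Rightarrow> ereal) \<Rightarrow> 'a \<Rightarrow> 'a" where
  "prox \<sigma> X h u = (SOME y. \<sigma> *\<^sub>R (u - y) \<in> subdiff X h y)"

locale moreau =
  fixes X :: "'a::euclidean_space set" and h :: "'a \<Rightarrow> ereal" and \<sigma> :: real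
  assumes X: "subspace X" and pcc: "proper_closed_convex X h" and \<sigma>: "\<sigma> > 0"
    and ex_subgradient: "\<exists>x v. v \<in> subdiff X h x"
begin

lemma prox_exists:
  assumes u: "u \<in> X"
  shows "\<exists>y. \<sigma> *\<^sub>R (u - y) \<in> subdiff X h y"
proof -
  obtain x0 v0 where v0: "v0 \<in> subdiff X h x0" using ex_subgradient by blast
  define c0 where "c0 = real_of_ereal (h x0)"
  have x0: "h x0 = ereal c0" "x0 \<in> X" using subdiff_real[OF v0] by (auto simp: c0_def)
  define E where "E = {(x, t). x \<in> X \<and> h x \<le> ereal t}"
  have E: "closed E" "convex E" and nm: "\<And>x. x \<in> X \<Longrightarrow> h x \<noteq> -\<infinity>"
    using pcc by (auto simp: proper_closed_convex_def E_def)
  define f where "f = (\<lambda>w::'a \<times> real. snd w + \<sigma> / 2 * (norm (fst w - u))\<^sup>2)"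
  have contf: "continuous_on UNIV f" unfolding f_def by (intro continuous_intros)
  define S where "S = E \<inter> {w. f w \<le> f (x0, c0)}"
  have low: "t \<ge> c0 + v0 \<bullet> (x - x0)" if "(x, t) \<in> E" for x t
  proof -
    have "x \<in> X" "h x \<le> ereal t" using that by (auto simp: E_def)
    then obtain s where "h x = ereal s" using nm by (cases "h x") auto
    with subdiff_ineq[OF v0 \<open>x \<in> X\<close>] \<open>h x \<le> ereal t\<close> show ?thesis by (force simp: c0_def)
  qed
  have "closed {w. f w \<le> f (x0, c0)}"
    using contf by (intro closed_Collect_le) (auto intro: continuous_on_const)
  then have "closed S" using E by (auto simp: S_def)
  moreover have "bounded S"
  proof -
    define a where "a = \<bar>f (x0, c0) - c0 - v0 \<bullet> (u - x0)\<bar>"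
    define R where "R = 1 + 2 / \<sigma> * (norm v0 + a)"
    define b where "b = \<bar>c0\<bar> + norm v0 * (R + norm (u - x0)) + \<bar>f (x0, c0)\<bar>"
    have R: "R \<ge> 1" using \<sigma> by (simp add: R_def a_def)
    have "norm w \<le> (R + norm u) + b" if "w \<in> S" for w
    proof -
      obtain x t where w: "w = (x, t)" by (cases w)
      have lt: "t \<ge> c0 + v0 \<bullet> (x - x0)" and ft: "t + \<sigma> / 2 * (norm (x - u))\<^sup>2 \<le> f (x0, c0)"
        using low that by (auto simp: w S_def f_def)
      define r where "r = norm (x - u)"
      have r0: "r \<ge> 0" by (simp add: r_def)
      have "v0 \<bullet> (x - x0) = v0 \<bullet> (u - x0) + v0 \<bullet> (x - u)" by (simp add: inner_diff_right)
      moreover have "\<bar>v0 \<bullet> (x - u)\<bar> \<le> norm v0 * r"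
        unfolding r_def by (rule Cauchy_Schwarz_ineq2)
      ultimately have q: "\<sigma> / 2 * r\<^sup>2 \<le> a + norm v0 * r"
        using lt ft unfolding a_def r_def by linarith
      have "r \<le> R"
      proof (rule ccontr)
        assume "\<not> r \<le> R"
        then have "r > R" "r > 1" using R by auto
        then have "\<sigma> / 2 * r * r > \<sigma> / 2 * R * r" using \<sigma> by simp
        also have "\<sigma> / 2 * R = \<sigma> / 2 + (norm v0 + a)" using \<sigma> by (simp add: R_def field_simps)
        finally have "\<sigma> / 2 * r * r > (\<sigma> / 2 + (norm v0 + a)) * r" by simp
        moreover have "a \<le> a * r" using \<open>r > 1\<close> mult_left_mono[of 1 r a] by (simp add: a_def)
        moreover have "\<sigma> / 2 * r > 0" using \<sigma> \<open>r > 1\<close> by simp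
        ultimately show False using q by (simp add: power2_eq_square algebra_simps)
      qed
      have "norm x \<le> R + norm u"
        using \<open>r \<le> R\<close> norm_triangle_ineq[of "x - u" u] by (simp add: r_def)
      moreover have "\<bar>t\<bar> \<le> b"
      proof -
        have "norm (x - x0) \<le> R + norm (u - x0)"
          using \<open>r \<le> R\<close> norm_triangle_ineq[of "x - u" "u - x0"] by (simp add: r_def)
        then have "\<bar>v0 \<bullet> (x - x0)\<bar> \<le> norm v0 * (R + norm (u - x0))"
          using Cauchy_Schwarz_ineq2[of v0 "x - x0"] mult_left_mono[of "norm (x - x0)" _ "norm v0"]
          by (meson norm_ge_zero order_trans)
        moreover have "t \<le> f (x0, c0)" using ft \<sigma> by (smt (verit) divide_pos_pos mult_nonneg_nonneg zero_le_power2)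
        moreover have "norm v0 * (R + norm (u - x0)) \<ge> 0" using R by simp
        ultimately show ?thesis using lt unfolding b_def by linarith
      qed
      ultimately show ?thesis
        using norm_Pair_le[of x t] by (simp add: w)
    qed
    then show ?thesis unfolding bounded_iff by blast
  qed
  ultimately have "compact S" by (simp add: compact_eq_bounded_closed)
  moreover have "(x0, c0) \<in> S" using x0 by (auto simp: S_def E_def)
  ultimately obtain w where w: "w \<in> S" "\<And>w'. w' \<in> S \<Longrightarrow> f w \<le> f w'"
    using continuous_attains_inf[of S f] contf continuous_on_subset by blast
  have min: "f w \<le> f w'" if "w' \<in> E" for w'
    using w that by (cases "w' \<in> S") (auto simp: S_def)
  obtain y t where yt: "w = (y, t)" by (cases w)
  have y: "y \<in> X" "h y \<le> ereal t" using w(1) by (auto simp: yt S_def E_def)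
  obtain s where s: "h y = ereal s" using y nm by (cases "h y") auto
  have "s = t"
    using min[of "(y, s)"] y s by (auto simp: E_def yt f_def)
  have "h y' \<ge> h y + ereal (\<sigma> *\<^sub>R (u - y) \<bullet> (y' - y))" if y': "y' \<in> X" for y'
  proof (cases "h y'")
    case (real t')
    define d where "d = (t' - t) + \<sigma> * ((y - u) \<bullet> (y' - y))"
    define e where "e = \<sigma> / 2 * (norm (y' - y))\<^sup>2"
    have step: "0 \<le> d + l * e" if l: "0 < l" "l \<le> 1" for l
    proof -
      have "(1 - l) *\<^sub>R (y, t) + l *\<^sub>R (y', t') \<in> E"
        using E(2) l y y' real s \<open>s = t\<close> by (intro convexD) (auto simp: E_def)
      from min[OF this] have "t + \<sigma> / 2 * (norm (y - u))\<^sup>2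
          \<le> (1 - l) * t + l * t' + \<sigma> / 2 * (norm ((1 - l) *\<^sub>R y + l *\<^sub>R y' - u))\<^sup>2"
        by (simp add: yt f_def)
      also have "(norm ((1 - l) *\<^sub>R y + l *\<^sub>R y' - u))\<^sup>2
          = (norm (y - u))\<^sup>2 + 2 * l * ((y - u) \<bullet> (y' - y)) + l\<^sup>2 * (norm (y' - y))\<^sup>2"
      proof -
        have *: "(1 - l) *\<^sub>R y + l *\<^sub>R y' - y = l *\<^sub>R (y' - y)" by (simp add: algebra_simps)
        show ?thesis by (subst norm_sq_shift[of _ _ y]) (simp add: * power_mult_distrib)
      qed
      finally have "0 \<le> l * (d + l * e)"
        by (simp add: d_def e_def algebra_simps power2_eq_square)
      then show ?thesis using l by (simp add: zero_le_mult_iff)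
    qed
    have "0 \<le> d"
    proof (rule ccontr)
      assume "\<not> 0 \<le> d"
      have "e \<ge> 0" using \<sigma> by (simp add: e_def)
      define l where "l = min 1 (- d / (2 * (e + 1)))"
      have l: "0 < l" "l \<le> 1" using \<open>\<not> 0 \<le> d\<close> \<open>e \<ge> 0\<close> by (auto simp: l_def divide_neg_pos)
      have "l * e \<le> l * (e + 1)" using l by (intro mult_left_mono) auto
      also have "\<dots> \<le> - d / (2 * (e + 1)) * (e + 1)"
        using \<open>e \<ge> 0\<close> by (intro mult_right_mono) (auto simp: l_def)
      also have "\<dots> = - d / 2" using \<open>e \<ge> 0\<close> by (simp add: field_simps)
      finally show False using step[OF l] \<open>\<not> 0 \<le> d\<close> by simp
    qed
    then have "t + \<sigma> *\<^sub>R (u - y) \<bullet> (y' - y) \<le> t'"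
      by (simp add: d_def inner_diff_left algebra_simps)
    then show ?thesis using real s \<open>s = t\<close> by simp
  qed (use nm y' in auto)
  then have "\<sigma> *\<^sub>R (u - y) \<in> subdiff X h y"
    using y s u X by (simp add: subdiff_def subspace_diff subspace_scale)
  then show ?thesis by blast
qed

abbreviation "P \<equiv> prox \<sigma> X h"

lemma prox_subgradient: "u \<in> X \<Longrightarrow> \<sigma> *\<^sub>R (u - P u) \<in> subdiff X h (P u)"
  unfolding prox_def by (rule someI_ex) (rule prox_exists)

lemma prox_in: "u \<in> X \<Longrightarrow> P u \<in> X"
  using prox_subgradient subdiff_real(2) by blast

lemma subgradients_nonexpansive:
  assumes "\<sigma> *\<^sub>R (u - y) \<in> subdiff X h y" "\<sigma> *\<^sub>R (u' - y') \<in> subdiff X h y'"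
  shows "(norm (y - y'))\<^sup>2 \<le> (u - u') \<bullet> (y - y')"
proof -
  have "0 \<le> \<sigma> * (((u - u') - (y - y')) \<bullet> (y - y'))"
    using subdiff_monotone[OF assms] by (simp add: inner_diff_left algebra_simps)
  then have "0 \<le> ((u - u') - (y - y')) \<bullet> (y - y')" using \<sigma> by (simp add: zero_le_mult_iff)
  then show ?thesis by (simp add: inner_diff_left power2_norm_eq_inner)
qed

lemma prox_unique:
  assumes "u \<in> X" "\<sigma> *\<^sub>R (u - y) \<in> subdiff X h y"
  shows "P u = y"
  using subgradients_nonexpansive[OF prox_subgradient[OF assms(1)] assms(2)] by simp

lemma prox_nonexpansive:
  assumes "u \<in> X" "u' \<in> X"
  shows "norm (P u - P u') \<le> norm (u - u')"
proof -
  have "norm (P u - P u') * norm (P u - P u') \<le> (u - u') \<bullet> (P u - P u')"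
    using subgradients_nonexpansive[OF prox_subgradient prox_subgradient] assms
    by (simp add: power2_eq_square)
  also have "\<dots> \<le> norm (u - u') * norm (P u - P u')" by (rule norm_cauchy_schwarz)
  finally show ?thesis
    by (cases "norm (P u - P u') = 0") (auto simp: mult_le_cancel_right)
qed

lemma prox_continuous: "continuous_on X P"
  using prox_nonexpansive by (intro continuous_onI) (force simp: dist_norm)

lemma prox_growth:
  assumes "u \<in> X" "y \<in> X" "h y = ereal t"
  shows "real_of_ereal (h (P u)) + \<sigma> / 2 * (norm (P u - u))\<^sup>2 + \<sigma> / 2 * (norm (y - P u))\<^sup>2
    \<le> t + \<sigma> / 2 * (norm (y - u))\<^sup>2"
proof -
  have "\<sigma> / 2 * (norm (y - u))\<^sup>2 = \<sigma> / 2 * (norm (P u - u))\<^sup>2 + \<sigma> * ((P u - u) \<bullet> (y - P u))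
      + \<sigma> / 2 * (norm (y - P u))\<^sup>2"
    by (subst norm_sq_shift[of y u "P u"]) (simp add: algebra_simps)
  moreover have "\<sigma> *\<^sub>R (u - P u) \<bullet> (y - P u) = - (\<sigma> * ((P u - u) \<bullet> (y - P u)))"
    by (simp add: inner_diff_left algebra_simps)
  ultimately show ?thesis
    using subdiff_ineq[OF prox_subgradient[OF assms(1)] assms(2,3)] by linarith
qed

lemma moreau_env_eq:
  assumes u: "u \<in> X"
  shows "moreau_env \<sigma> X h u = real_of_ereal (h (P u)) + \<sigma> / 2 * (norm (P u - u))\<^sup>2"
proof -
  note hP = subdiff_real(1)[OF prox_subgradient[OF u]]
  have nm: "\<And>x. x \<in> X \<Longrightarrow> h x \<noteq> -\<infinity>" using pcc by (auto simp: proper_closed_convex_def)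
  have "(INF y\<in>X. h y + ereal (\<sigma> / 2 * (norm (y - u))\<^sup>2))
      = h (P u) + ereal (\<sigma> / 2 * (norm (P u - u))\<^sup>2)"
  proof (rule antisym)
    show "(INF y\<in>X. h y + ereal (\<sigma> / 2 * (norm (y - u))\<^sup>2))
        \<le> h (P u) + ereal (\<sigma> / 2 * (norm (P u - u))\<^sup>2)"
      by (rule INF_lower) (rule prox_in[OF u])
    show "h (P u) + ereal (\<sigma> / 2 * (norm (P u - u))\<^sup>2)
        \<le> (INF y\<in>X. h y + ereal (\<sigma> / 2 * (norm (y - u))\<^sup>2))"
    proof (rule INF_greatest)
      fix y assume y: "y \<in> X"
      show "h (P u) + ereal (\<sigma> / 2 * (norm (P u - u))\<^sup>2) \<le> h y + ereal (\<sigma> / 2 * (norm (y - u))\<^sup>2)"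
      proof (cases "h y")
        case (real t)
        have "\<sigma> / 2 * (norm (y - P u))\<^sup>2 \<ge> 0" using \<sigma> by simp
        with prox_growth[OF u y real] have
          "ereal (real_of_ereal (h (P u)) + \<sigma> / 2 * (norm (P u - u))\<^sup>2) \<le> ereal (t + \<sigma> / 2 * (norm (y - u))\<^sup>2)"
          by simp
        then show ?thesis by (subst hP) (simp add: real)
      qed (use nm y in auto)
    qed
  qed
  then show ?thesis unfolding moreau_env_def by (subst (asm) hP) simp
qed

lemma has_derivative_moreau_env:
  assumes u: "u \<in> X"
  shows "(moreau_env \<sigma> X h has_derivative (\<lambda>v. \<sigma> *\<^sub>R (u - P u) \<bullet> v)) (at u within X)"
  unfolding has_derivative_within_alt
proof (intro conjI allI impI)
  show "bounded_linear (\<lambda>v. \<sigma> *\<^sub>R (u - P u) \<bullet> v)" by (rule bounded_linear_inner_right)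
  have upper: "moreau_env \<sigma> X h a - moreau_env \<sigma> X h b \<le> \<sigma> * ((b - P b) \<bullet> (a - b)) + \<sigma> / 2 * (norm (a - b))\<^sup>2"
    if "a \<in> X" "b \<in> X" for a b
  proof -
    have "\<sigma> / 2 * (norm (P b - P a))\<^sup>2 \<ge> 0" using \<sigma> by simp
    then have "moreau_env \<sigma> X h a \<le> real_of_ereal (h (P b)) + \<sigma> / 2 * (norm (P b - a))\<^sup>2"
      using prox_growth[OF that(1) prox_in[OF that(2)] subdiff_real(1)[OF prox_subgradient[OF that(2)]]]
      by (simp add: moreau_env_eq[OF that(1)])
    then show ?thesis
      using norm_sq_shift[of a "P b" b] that
      by (simp add: moreau_env_eq norm_minus_commute[of "P b"] algebra_simps)
  qed
  have bound: "\<bar>moreau_env \<sigma> X h u' - moreau_env \<sigma> X h u - \<sigma> * ((u - P u) \<bullet> (u' - u))\<bar>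
      \<le> \<sigma> / 2 * (norm (u' - u))\<^sup>2" if u': "u' \<in> X" for u'
  proof -
    have "(P u' - P u) \<bullet> (u' - u) \<le> norm (P u' - P u) * norm (u' - u)" by (rule norm_cauchy_schwarz)
    also have "\<dots> \<le> norm (u' - u) * norm (u' - u)"
      by (intro mult_right_mono prox_nonexpansive u u') auto
    finally have "(u - P u) \<bullet> (u' - u) \<le> (u' - P u') \<bullet> (u' - u)"
      by (simp add: power2_norm_eq_inner[symmetric] power2_eq_square[symmetric] inner_diff_left)
        (simp add: power2_norm_eq_inner inner_diff_left inner_diff_right inner_commute)
    then have "\<sigma> * ((u - P u) \<bullet> (u' - u)) \<le> \<sigma> * ((u' - P u') \<bullet> (u' - u))"
      using \<sigma> by (intro mult_left_mono) auto
    moreover have "(u' - P u') \<bullet> (u - u') = - ((u' - P u') \<bullet> (u' - u))"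
      by (simp add: inner_diff_right)
    ultimately show ?thesis
      using upper[OF u' u] upper[OF u u', unfolded norm_minus_commute[of u u']]
      by (simp only: abs_le_iff) linarith
  qed
  fix \<epsilon> :: real assume "\<epsilon> > 0"
  show "\<exists>d>0. \<forall>u'\<in>X. norm (u' - u) < d \<longrightarrow>
      norm (moreau_env \<sigma> X h u' - moreau_env \<sigma> X h u - \<sigma> *\<^sub>R (u - P u) \<bullet> (u' - u)) \<le> \<epsilon> * norm (u' - u)"
  proof (intro exI[of _ "2 * \<epsilon> / \<sigma>"] conjI ballI impI)
    show "2 * \<epsilon> / \<sigma> > 0" using \<sigma> \<open>\<epsilon> > 0\<close> by simp
    fix u' assume u': "u' \<in> X" and "norm (u' - u) < 2 * \<epsilon> / \<sigma>"
    then have "\<sigma> / 2 * norm (u' - u) \<le> \<epsilon>" using \<sigma> by (simp add: field_simps)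
    then have "\<sigma> / 2 * norm (u' - u) * norm (u' - u) \<le> \<epsilon> * norm (u' - u)" by (intro mult_right_mono) auto
    then show "norm (moreau_env \<sigma> X h u' - moreau_env \<sigma> X h u - \<sigma> *\<^sub>R (u - P u) \<bullet> (u' - u)) \<le> \<epsilon> * norm (u' - u)"
      using bound[OF u'] by (simp add: power2_eq_square)
  qed
qed

lemma Ck_on_moreau_env:
  assumes U: "U \<subseteq> X" and P: "Ck_on k X U P"
  shows "Ck_on (Suc k) X U (moreau_env \<sigma> X h)"
  unfolding Ck_on.simps
proof (intro exI[of _ "\<lambda>u v. \<sigma> *\<^sub>R (u - P u) \<bullet> v"] conjI ballI)
  show "(moreau_env \<sigma> X h has_derivative (\<lambda>v. \<sigma> *\<^sub>R (u - P u) \<bullet> v)) (at u within U)" if "u \<in> U" for u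
    using has_derivative_moreau_env has_derivative_subset U that by blast
  show "Ck_on k X U (\<lambda>u. \<sigma> *\<^sub>R (u - P u) \<bullet> v)" for v
    by (intro Ck_on_inner Ck_on_scaleR Ck_on_const Ck_on_diff Ck_on_ident P)
qed

end


section \<open>Manifolds as graphs over their tangent space\<close>

lemma tangent_space_subset_kernel:
  fixes M :: "'a::euclidean_space set"
  assumes X: "subspace X" and M: "M \<subseteq> X" and U: "openin (top_of_set X) U" "x \<in> U"
    and G: "\<And>y. y \<in> M \<inter> U \<Longrightarrow> G y = 0" "(G has_derivative G') (at x within U)"
    and w: "w \<in> tangent_space M x"
  shows "w \<in> X" "G' w = 0"
proof -
  obtain c \<epsilon> where c: "\<epsilon> > 0" "c ` {-\<epsilon><..<\<epsilon>} \<subseteq> M" "c 0 = x" "(c has_vector_derivative w) (at 0)"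
    using w by (auto simp: tangent_space_def)
  have dc: "(c has_derivative (\<lambda>r. r *\<^sub>R w)) (at 0 within S)" for S
    using c(4) has_derivative_at_withinI unfolding has_vector_derivative_def by blast
  have "1 *\<^sub>R w \<in> X"
    by (rule has_derivative_in_subspace[OF dc, where X = UNIV and U = "{-\<epsilon><..<\<epsilon>}"])
      (use c M X in auto)
  then show "w \<in> X" by simp
  obtain S where S: "open S" "U = X \<inter> S" using U(1) by (meson openin_open)
  have "isCont c 0" using has_vector_derivative_continuous[OF c(4)] .
  then have "\<forall>\<^sub>F r in nhds 0. c r \<in> S"
    using S U(2) c(3) by (simp add: continuous_at_open eventually_nhds)
  then obtain d where d: "d > 0" "\<And>r. dist r 0 < d \<Longrightarrow> c r \<in> S"
    by (auto simp: eventually_nhds_metric)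
  define B where "B = ball (0::real) (min d \<epsilon>)"
  have B: "c r \<in> M \<inter> U" if "r \<in> B" for r
    using that d(2)[of r] c(2) M S(2) by (force simp: B_def dist_real_def image_subset_iff)
  have "0 \<in> B" "open B" using d c by (auto simp: B_def)
  have "((\<lambda>r. G (c r)) has_derivative (\<lambda>r. G' (r *\<^sub>R w))) (at 0 within B)"
  proof (rule has_derivative_in_compose[OF dc, where g = G and g' = G'])
    show "(G has_derivative G') (at (c 0) within c ` B)"
      unfolding c(3) by (rule has_derivative_subset[OF G(2)]) (use B in blast)
  qed
  then have "((\<lambda>r. G (c r)) has_derivative (\<lambda>r. G' (r *\<^sub>R w))) (at 0)"
    by (simp add: at_within_open[OF \<open>0 \<in> B\<close> \<open>open B\<close>])
  moreover have "((\<lambda>r. G (c r)) has_derivative (\<lambda>r. 0)) (at 0 within B)"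
    by (rule has_derivative_transform[OF \<open>0 \<in> B\<close> _ has_derivative_const]) (use G(1) B in auto)
  then have "((\<lambda>r. G (c r)) has_derivative (\<lambda>r. 0)) (at 0)"
    by (simp add: at_within_open[OF \<open>0 \<in> B\<close> \<open>open B\<close>])
  ultimately have "(\<lambda>r. G' (r *\<^sub>R w)) = (\<lambda>r. 0)" by (rule has_derivative_unique)
  from fun_cong[OF this, of 1] show "G' w = 0" by simp
qed

lemma normalized_equation:
  fixes M :: "'a::euclidean_space set"
  assumes X: "subspace X" and emb: "embedded_submanifold (Suc q) X M" and x0: "x0 \<in> M"
  obtains T N U G G' where "subspace T" "T \<subseteq> X" "subspace N" "N \<subseteq> normal_space X M x0"
    "N = {n \<in> X. \<forall>t\<in>T. n \<bullet> t = 0}" "openin (top_of_set X) U" "x0 \<in> U"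
    "Ck_on (Suc q) X U G" "G ` U \<subseteq> N" "M \<inter> U = {y \<in> U. G y = 0}"
    "(G has_derivative G') (at x0 within U)" "\<forall>v\<in>X. G' v = v - oproj T v"
proof -
  have MX: "M \<subseteq> X" using emb by (simp add: embedded_submanifold_def)
  obtain U Z and H :: "'a \<Rightarrow> 'a" where U: "openin (top_of_set X) U" "x0 \<in> U" and Z: "H ` U \<subseteq> Z"
    and H: "Ck_on (Suc q) X U H" "M \<inter> U = {y \<in> U. H y = 0}"
    and onto: "\<exists>J. (H has_derivative J) (at x0 within U) \<and> J ` X = Z"
    using emb x0 unfolding embedded_submanifold_def by blast
  obtain J where J: "(H has_derivative J) (at x0 within U)" "J ` X = Z" using onto by blast
  interpret J: bounded_linear J using J(1) by (rule has_derivative_bounded_linear)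
  define T where "T = {w \<in> X. J w = 0}"
  define N where "N = {n \<in> X. \<forall>t\<in>T. n \<bullet> t = 0}"
  have T: "subspace T" "T \<subseteq> X"
    using X by (auto simp: T_def subspace_def J.zero J.add J.scaleR)
  have N: "subspace N"
    using X by (auto simp: N_def subspace_def inner_add_left)
  have proj: "v - oproj T v \<in> N" if "v \<in> X" for v
    using that T X oproj_in[OF T(1)] oproj_inner[OF T(1)]
    by (auto simp: N_def inner_diff_left intro!: subspace_diff)
  have JN: "J v = J (v - oproj T v)" for v
    using oproj_in[OF T(1), of v] by (simp add: J.diff T_def)
  obtain L where L: "bounded_linear L" "\<And>c. L c \<in> N" "\<And>n. n \<in> N \<Longrightarrow> L (J n) = n"
  proof (rule left_inverse_on[of J N])
    fix n assume n: "n \<in> N" "J n = 0"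
    then have "n \<in> T" by (auto simp: N_def T_def)
    then have "n \<bullet> n = 0" using n by (auto simp: N_def)
    then show "n = 0" by simp
  qed (use N J.linear_axioms in auto)
  interpret L: bounded_linear L by (rule L(1))
  have LJ: "L (J v) = v - oproj T v" if "v \<in> X" for v
    using L(3)[OF proj[OF that]] JN by metis
  have LZ: "L z = 0 \<longleftrightarrow> z = 0" if "z \<in> Z" for z
  proof -
    obtain w where w: "w \<in> X" "z = J w" using \<open>z \<in> Z\<close> J(2) by blast
    show ?thesis
      using LJ[OF w(1)] JN[of w] by (auto simp: w(2) L.zero J.zero)
  qed
  show ?thesis
  proof (rule that[of T N U "\<lambda>y. L (H y)" "\<lambda>v. L (J v)"])
    show "N \<subseteq> normal_space X M x0"
    proof
      fix n assume n: "n \<in> N"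
      have "w \<in> T" if "w \<in> tangent_space M x0" for w
        using tangent_space_subset_kernel[OF X MX U _ J(1) that] H(2) by (auto simp: T_def)
      with n show "n \<in> normal_space X M x0"
        by (auto simp: N_def normal_space_def orthogonal_comp_def orthogonal_def inner_commute)
    qed
    show "M \<inter> U = {y \<in> U. L (H y) = 0}" using H(2) LZ Z by (auto simp: image_subset_iff)
    show "Ck_on (Suc q) X U (\<lambda>y. L (H y))" by (rule Ck_on_bounded_linear_compose[OF L(1) H(1)])
    show "((\<lambda>y. L (H y)) has_derivative (\<lambda>v. L (J v))) (at x0 within U)"
      by (rule bounded_linear.has_derivative[OF L(1) J(1)])
  qed (use T N U L LJ in \<open>auto simp: N_def\<close>)
qed

lemma graph_chart:
  fixes M :: "'a::euclidean_space set"
  assumes X: "subspace X" and emb: "embedded_submanifold (Suc q) X M" and x0: "x0 \<in> M"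
  obtains T Q V \<Xi> where "subspace T" "T \<subseteq> X" "{n \<in> X. \<forall>t\<in>T. n \<bullet> t = 0} \<subseteq> normal_space X M x0"
    "openin (top_of_set X) Q" "x0 \<in> Q" "openin (top_of_set T) V" "Ck_on (Suc q) T V \<Xi>"
    "oproj T x0 \<in> V" "\<forall>t\<in>V. \<Xi> t \<in> M \<and> oproj T (\<Xi> t) = t"
    "\<forall>y\<in>M \<inter> Q. oproj T y \<in> V \<and> \<Xi> (oproj T y) = y"
proof -
  obtain T N U G G0' where T: "subspace T" "T \<subseteq> X" and N: "subspace N" "N \<subseteq> normal_space X M x0"
    and N_eq: "N = {n \<in> X. \<forall>t\<in>T. n \<bullet> t = 0}" and U: "openin (top_of_set X) U" "x0 \<in> U"
    and G: "Ck_on (Suc q) X U G" "G ` U \<subseteq> N" and MU: "M \<inter> U = {y \<in> U. G y = 0}"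
    and G0': "(G has_derivative G0') (at x0 within U)" "\<forall>v\<in>X. G0' v = v - oproj T v"
    by (rule normalized_equation[OF assms])
  have MX: "M \<subseteq> X" using emb by (simp add: embedded_submanifold_def)
  have UX: "U \<subseteq> X" using U(1) openin_subset by force
  obtain G' where G': "\<And>y. y \<in> U \<Longrightarrow> (G has_derivative G' y) (at y within U)"
    "\<And>v. v \<in> X \<Longrightarrow> Ck_on q X U (\<lambda>y. G' y v)" using G(1) by auto
  define \<Theta> where "\<Theta> = (\<lambda>y. oproj T y + G (oproj X y) + (y - oproj X y))"
  define D where "D = (\<lambda>y v. oproj T v + G' (oproj X y) (oproj X v) + (v - oproj X v))"
  define W where "W = {y. oproj X y \<in> U}"
  obtain S where S: "open S" "U = X \<inter> S" using U(1) by (meson openin_open)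
  have "W = oproj X -` S" using S oproj_in[OF X] by (auto simp: W_def)
  moreover have cont: "continuous_on A (oproj X)" for A
    using bounded_linear_oproj by (rule linear_continuous_on)
  ultimately have W: "open W" using S(1) open_vimage by blast
  have x0X: "oproj X x0 = x0" using oproj_id[OF X] x0 MX by blast
  have x0W: "x0 \<in> W" using x0X U(2) by (simp add: W_def)
  have d\<Theta>: "(\<Theta> has_derivative D y) (at y)" if "y \<in> W" for y
  proof -
    have "((\<lambda>y. G (oproj X y)) has_derivative (\<lambda>v. G' (oproj X y) (oproj X v))) (at y within W)"
      by (rule has_derivative_in_compose2[of U G G', OF G'(1)])
        (use that bounded_linear_imp_has_derivative[OF bounded_linear_oproj] in \<open>auto simp: W_def\<close>)
    then have "((\<lambda>y. G (oproj X y)) has_derivative (\<lambda>v. G' (oproj X y) (oproj X v))) (at y)"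
      by (simp add: at_within_open[OF that W])
    then show ?thesis
      unfolding \<Theta>_def D_def
      by (intro has_derivative_add has_derivative_diff has_derivative_ident
          bounded_linear_imp_has_derivative bounded_linear_oproj)
  qed
  have blD: "bounded_linear (D y)" if "y \<in> W" for y
    using d\<Theta>[OF that] by (rule has_derivative_bounded_linear)
  have contD: "continuous_on W (\<lambda>y. Blinfun (D y))"
  proof (rule continuous_on_blinfun_componentwise)
    fix i :: 'a assume "i \<in> Basis"
    have "continuous_on W (\<lambda>y. G' (oproj X y) (oproj X i))"
      using Ck_on_continuous[OF G'(2)[OF oproj_in[OF X]]] cont
      by (rule continuous_on_compose2) (auto simp: W_def)
    then have "continuous_on W (\<lambda>y. D y i)"
      unfolding D_def by (intro continuous_intros)
    then show "continuous_on W (\<lambda>y. Blinfun (D y) i)"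
      by (rule continuous_on_eq) (simp add: bounded_linear_Blinfun_apply blD)
  qed
  have "D x0 v = v" for v
  proof -
    have "G' x0 (oproj X v) = G0' (oproj X v)"
      using has_derivative_unique_on_subspace[OF G'(1)[OF U(2)] G0'(1) U(1) X U(2)] oproj_in[OF X] by blast
    also have "\<dots> = oproj X v - oproj T (oproj X v)" using G0'(2) oproj_in[OF X] by blast
    also have "oproj T (oproj X v) = oproj T v"
      using T oproj_inner[OF X] oproj_inner[OF T(1)] oproj_in[OF T(1)]
      by (intro oproj_unique) (auto simp: subset_iff)
    finally show ?thesis by (simp add: D_def x0X)
  qed
  then have "id_blinfun o\<^sub>L Blinfun (D x0) = id_blinfun"
    by (intro blinfun_eqI) (simp add: bounded_linear_Blinfun_apply blD x0W)
  then obtain U' V' g g' where U': "open U'" "U' \<subseteq> W" "x0 \<in> U'" and V': "open V'"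
    and hom: "homeomorphism U' V' \<Theta> g"
    and bij: "\<And>t. t \<in> V' \<Longrightarrow> bij (blinfun_apply (Blinfun (D (g t))))"
    using inverse_function_theorem[OF W, of \<Theta> "\<lambda>y. Blinfun (D y)" x0]
      d\<Theta> contD x0W by (simp add: bounded_linear_Blinfun_apply blD) metis
  define Q where "Q = X \<inter> U'"
  define V where "V = T \<inter> V'"
  have QU: "Q \<subseteq> U" using U' oproj_id[OF X] by (auto simp: Q_def W_def)
  have \<Theta>Q: "\<Theta> y = oproj T y + G y" if "y \<in> Q" for y
    using that oproj_id[OF X] by (simp add: Q_def \<Theta>_def)
  have inv: "\<Theta> (g t) = t" "g t \<in> U'" if "t \<in> V'" for t
    using hom that by (auto simp: homeomorphism_def)
  have inv': "g (\<Theta> y) = y" "\<Theta> y \<in> V'" if "y \<in> U'" for y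
    using hom that by (auto simp: homeomorphism_def)
  have TN: "oproj T n = 0" if "n \<in> N" for n
    using that T by (intro oproj_unique) (auto simp: N_eq subspace_0)
  have NX: "N \<subseteq> X" by (auto simp: N_eq)
  have gQ: "g t \<in> Q" if "t \<in> V" for t
  proof -
    have t: "t \<in> V'" "t \<in> X" using that T by (auto simp: V_def)
    have "oproj X (g t) \<in> U" using inv(2)[OF t(1)] U' by (auto simp: W_def)
    then have "G (oproj X (g t)) \<in> X" using G(2) NX by blast
    moreover have "g t - oproj X (g t) = t - oproj T (g t) - G (oproj X (g t))"
      using inv(1)[OF t(1)] by (simp add: \<Theta>_def algebra_simps)
    ultimately have "g t - oproj X (g t) \<in> X"
      using X T(2) oproj_in[OF T(1)] t(2) by (auto intro!: subspace_diff)
    then have "g t \<in> X" using oproj_in[OF X] X by (metis diff_add_cancel subspace_add)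
    then show ?thesis using inv(2) t(1) by (simp add: Q_def)
  qed
  have GN: "G y \<in> N" if "y \<in> Q" for y using that G(2) QU by blast
  have g: "oproj T (g t) = t" "g t \<in> M" if "t \<in> V" for t
  proof -
    have "t \<in> T" "t \<in> V'" using that by (auto simp: V_def)
    have *: "t = oproj T (g t) + G (g t)" using inv(1)[OF \<open>t \<in> V'\<close>] \<Theta>Q gQ[OF that] by simp
    then have "oproj T t = oproj T (oproj T (g t)) + oproj T (G (g t))"
      using linear_add[OF linear_oproj] by metis
    then show "oproj T (g t) = t"
      using TN[OF GN[OF gQ[OF that]]] oproj_id[OF T(1)] oproj_in[OF T(1)] \<open>t \<in> T\<close> by simp
    with * have "G (g t) = 0" by simp
    then show "g t \<in> M" using gQ[OF that] QU MU by blast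
  qed
  have M: "oproj T y \<in> V \<and> g (oproj T y) = y" if "y \<in> M \<inter> Q" for y
  proof -
    have "\<Theta> y = oproj T y" using that \<Theta>Q QU MU by auto
    then show ?thesis using inv'[of y] that oproj_in[OF T(1)] by (auto simp: Q_def V_def)
  qed
  have oQ: "openin (top_of_set X) Q" and oV: "openin (top_of_set T) V"
    using U' V' by (auto simp: Q_def V_def openin_open)
  have oQV: "openin (top_of_set (X \<times> T)) (Q \<times> V)" using oQ oV by (simp add: openin_Times)
  have "Ck_on (Suc q) T V g"
  proof (rule Ck_on_implicit[OF T(1) oV X, where W = "Q \<times> V"
        and K = "\<lambda>w. oproj T (fst w) + G (fst w) - snd w"])
    show "continuous_on V g" using hom by (auto simp: homeomorphism_def V_def intro: continuous_on_subset)
    show "g t \<in> X" if "t \<in> V" for t using gQ[OF that] by (simp add: Q_def)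
    show "openin (top_of_set (X \<times> T)) (Q \<times> V)" by (rule oQV)
    show "(g t, t) \<in> Q \<times> V" if "t \<in> V" for t using gQ that by simp
    have fst: "Ck_on (Suc q) (X \<times> T) (Q \<times> V) fst" and snd: "Ck_on (Suc q) (X \<times> T) (Q \<times> V) snd"
      by (simp_all only: Ck_on_bounded_linear bounded_linear_fst bounded_linear_snd)
    show "Ck_on (Suc q) (X \<times> T) (Q \<times> V) (\<lambda>w. oproj T (fst w) + G (fst w) - snd w)"
    proof (intro Ck_on_add Ck_on_diff snd Ck_on_bounded_linear_compose[OF bounded_linear_oproj] fst)
      show "Ck_on (Suc q) (X \<times> T) (Q \<times> V) (\<lambda>w. G (fst w))"
        by (rule Ck_on_compose[OF _ oQV X _ UX fst G(1)]) (use X T QU in \<open>auto simp: subspace_Times\<close>)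
    qed
    show "oproj T (fst (g t, t)) + G (fst (g t, t)) - snd (g t, t) = 0" if "t \<in> V" for t
      using \<Theta>Q[OF gQ[OF that]] inv(1)[of t] that by (simp add: V_def)
    fix t E y
    assume t: "t \<in> V" and y: "y \<in> X" and E0: "E (y, 0) = 0"
      and E: "((\<lambda>w. oproj T (fst w) + G (fst w) - snd w) has_derivative E) (at (g t, t) within Q \<times> V)"
    have gt: "g t \<in> W" using inv(2)[of t] t U' by (auto simp: V_def)
    have "((\<lambda>r. oproj T (fst ((g t, t) + r *\<^sub>R (y, 0))) + G (fst ((g t, t) + r *\<^sub>R (y, 0)))
        - snd ((g t, t) + r *\<^sub>R (y, 0))) has_vector_derivative E (y, 0)) (at 0)"
      by (rule has_derivative_directional[OF E oQV]) (use X T t y gQ in \<open>auto simp: subspace_Times subspace_0\<close>)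
    then have 1: "((\<lambda>r. oproj T (g t + r *\<^sub>R y) + G (g t + r *\<^sub>R y) - t) has_vector_derivative 0) (at 0)"
      by (simp add: E0)
    have "((\<lambda>r. \<Theta> (g t + r *\<^sub>R y)) has_vector_derivative D (g t) y) (at 0)"
      by (rule has_derivative_directional[OF d\<Theta>[OF gt], of UNIV]) auto
    then have 2: "((\<lambda>r. \<Theta> (g t + r *\<^sub>R y) - t) has_vector_derivative D (g t) y) (at 0)"
      by (auto intro!: derivative_eq_intros)
    have "g t + r *\<^sub>R y \<in> X" for r
      using gQ[OF t] y X by (auto simp: Q_def intro: subspace_add subspace_scale)
    then have "(\<lambda>r. \<Theta> (g t + r *\<^sub>R y) - t)
        = (\<lambda>r. oproj T (g t + r *\<^sub>R y) + G (g t + r *\<^sub>R y) - t)"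
      using oproj_id[OF X] by (simp add: \<Theta>_def)
    from vector_derivative_unique_at[OF 2[unfolded this] 1] have "D (g t) y = 0" .
    moreover have "inj (D (g t))"
      using bij[of t] t by (simp add: V_def bounded_linear_Blinfun_apply blD[OF gt] bij_is_inj)
    moreover have "D (g t) 0 = 0" using linear_0 bounded_linear.linear[OF blD[OF gt]] by blast
    ultimately show "y = 0" by (metis injD)
  qed
  moreover have "x0 \<in> Q" using U' x0 MX by (auto simp: Q_def)
  ultimately show ?thesis
    using that[of T Q V g] T N(2) oQ oV g M x0 unfolding N_eq by blast
qed


section \<open>Smoothness of the proximal map\<close>

lemma no_quadratic_growth:
  fixes \<psi> \<phi> :: "real \<Rightarrow> real"
  assumes d: "d > 0" and \<psi>: "\<And>r. \<bar>r\<bar> < d \<Longrightarrow> (\<psi> has_real_derivative \<phi> r) (at r)"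
    and \<phi>: "(\<phi> has_real_derivative 0) (at 0)" "\<phi> 0 = 0"
    and growth: "\<And>r. \<bar>r\<bar> < d \<Longrightarrow> \<psi> r \<ge> \<psi> 0 + c * r\<^sup>2"
  shows "c \<le> 0"
proof (rule ccontr)
  assume "\<not> c \<le> 0"
  have "\<exists>d>0. \<forall>y. norm (y - 0) < d \<longrightarrow> norm (\<phi> y - \<phi> 0 - 0 * (y - 0)) \<le> c / 2 * norm (y - 0)"
    using \<phi>(1)[unfolded has_field_derivative_def has_derivative_at_alt, THEN conjunct2,
      rule_format, of "c / 2"] \<open>\<not> c \<le> 0\<close> by simp
  then obtain e where e: "e > 0" "\<And>y. \<bar>y\<bar> < e \<Longrightarrow> \<bar>\<phi> y\<bar> \<le> c / 2 * \<bar>y\<bar>"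
    using \<phi>(2) by auto
  define r where "r = min d e / 2"
  have r: "0 < r" "r < d" "r < e" using d e by (auto simp: r_def)
  obtain y where y: "0 < y" "y < r" "\<psi> r - \<psi> 0 = (r - 0) * \<phi> y"
    using MVT2[of 0 r \<psi> \<phi>] r \<psi> by auto
  have "c * y \<le> c * r" using y \<open>\<not> c \<le> 0\<close> by simp
  moreover have "\<bar>\<phi> y\<bar> \<le> c / 2 * y" using e(2)[of y] y r by simp
  ultimately have "\<phi> y \<le> c / 2 * r" by linarith
  then have "\<psi> r - \<psi> 0 \<le> r * (c / 2 * r)" using y(3) r by (simp add: mult_left_mono)
  with growth[of r] r have "c * r\<^sup>2 \<le> c * r\<^sup>2 / 2" by (simp add: power2_eq_square algebra_simps)
  then show False using \<open>\<not> c \<le> 0\<close> r by (simp add: mult_le_0_iff)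
qed

lemma rel_interior_perturb:
  fixes C :: "'a::euclidean_space set"
  assumes v: "v \<in> rel_interior C" and e: "e \<in> parallel_subspace C"
  shows "\<forall>\<^sub>F \<delta> in at_right 0. v + \<delta> *\<^sub>R e \<in> C"
proof -
  obtain \<epsilon> where \<epsilon>: "v \<in> C" "\<epsilon> > 0" "ball v \<epsilon> \<inter> affine hull C \<subseteq> C"
    using v by (auto simp: mem_rel_interior_ball)
  have *: "v + w \<in> affine hull C" if w: "w \<in> parallel_subspace C" for w
  proof -
    have aff: "affine (affine hull C)" by (rule affine_affine_hull)
    have vC: "v \<in> affine hull C" using \<epsilon>(1) by (rule hull_inc)
    from w show ?thesis unfolding parallel_subspace_def
    proof (induction w rule: span_induct_alt)
      case base
      show ?case using vC by simp
    next
      case (step t x y)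
      then obtain a b where ab: "x = a - b" "a \<in> C" "b \<in> C" by auto
      have "v + y + t *\<^sub>R (a - b) \<in> affine hull C"
        using mem_affine_3_minus[OF aff step(2) hull_inc[OF ab(2)] hull_inc[OF ab(3)]] .
      then show ?case by (simp add: ab(1) algebra_simps)
    qed
  qed
  have "((\<lambda>\<delta>. v + \<delta> *\<^sub>R e) \<longlongrightarrow> v + 0 *\<^sub>R e) (at_right 0)" by (intro tendsto_intros)
  then have "\<forall>\<^sub>F \<delta> in at_right 0. v + \<delta> *\<^sub>R e \<in> ball v \<epsilon>"
    by (rule topological_tendstoD) (use \<epsilon>(2) in auto)
  then show ?thesis
  proof eventually_elim
    case (elim \<delta>)
    have "\<delta> *\<^sub>R e \<in> parallel_subspace C"
      using e unfolding parallel_subspace_def by (rule span_mul)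
    with *[of "\<delta> *\<^sub>R e"] elim \<epsilon>(3) show ?case by blast
  qed
qed

context moreau
begin

lemma prox_identifies_manifold:
  assumes v0: "v0 \<in> rel_interior (subdiff X h x0)"
    and emb: "embedded_submanifold (Suc q) X M" and x0: "x0 \<in> M"
    and par: "parallel_subspace (subdiff X h x0) = normal_space X M x0"
    and V: "open S" "v0 \<in> S" "inner_semicontinuous_at (\<lambda>y. S \<inter> subdiff X h y) x0 M"
  shows "\<exists>d>0. \<forall>u\<in>X. dist u (x0 + v0 /\<^sub>R \<sigma>) < d \<longrightarrow> P u \<in> M"
proof (rule ccontr)
  define u0 where "u0 = x0 + v0 /\<^sub>R \<sigma>"
  obtain T Q V \<Xi> where T: "subspace T" "T \<subseteq> X" and N: "{n \<in> X. \<forall>t\<in>T. n \<bullet> t = 0} \<subseteq> normal_space X M x0"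
    and Q: "openin (top_of_set X) Q" "x0 \<in> Q" and V: "openin (top_of_set T) V"
    and \<Xi>: "Ck_on (Suc q) T V \<Xi>" "oproj T x0 \<in> V" "\<forall>t\<in>V. \<Xi> t \<in> M \<and> oproj T (\<Xi> t) = t"
      "\<forall>y\<in>M \<inter> Q. oproj T y \<in> V \<and> \<Xi> (oproj T y) = y"
    by (rule graph_chart[OF X emb x0])
  have MX: "M \<subseteq> X" using emb by (simp add: embedded_submanifold_def)
  have v0': "v0 \<in> subdiff X h x0" using v0 rel_interior_subset by blast
  have u0X: "u0 \<in> X"
    using subdiff_real(2,3)[OF v0'] X by (simp add: u0_def subspace_add subspace_scale)
  have Pu0: "P u0 = x0"
    using \<sigma> v0' by (intro prox_unique[OF u0X]) (simp add: u0_def)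
  assume neg: "\<not> (\<exists>d>0. \<forall>u\<in>X. dist u (x0 + v0 /\<^sub>R \<sigma>) < d \<longrightarrow> P u \<in> M)"
  have "\<exists>u. u \<in> X \<and> dist u u0 < d \<and> P u \<notin> M" if "d > 0" for d
    using neg that unfolding u0_def by blast
  then have "\<exists>u. u \<in> X \<and> dist u u0 < 1 / real (Suc k) \<and> P u \<notin> M" for k
    by simp
  then obtain u where u: "\<And>k. u k \<in> X" "\<And>k. dist (u k) u0 < 1 / real (Suc k)" "\<And>k. P (u k) \<notin> M"
    by metis
  have u_lim: "u \<longlonglongrightarrow> u0"
  proof (rule metric_LIMSEQ_I)
    fix r :: real assume "r > 0"
    then obtain K where K: "1 / real (Suc K) < r" using nat_approx_posE by blast
    have "dist (u k) u0 < r" if "k \<ge> K" for k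
    proof -
      have "1 / real (Suc k) \<le> 1 / real (Suc K)" using that by (simp add: frac_le)
      then show ?thesis using u(2)[of k] K by linarith
    qed
    then show "\<exists>K. \<forall>k\<ge>K. dist (u k) u0 < r" by blast
  qed
  define y where "y = (\<lambda>k. P (u k))"
  have yX: "y k \<in> X" for k by (simp add: y_def prox_in u)
  have y_lim: "y \<longlonglongrightarrow> x0"
    unfolding y_def Pu0[symmetric]
    by (rule continuous_on_tendsto_compose[OF prox_continuous u_lim u0X]) (simp add: u)
  define m where "m = (\<lambda>k. \<Xi> (oproj T (y k)))"
  have t_lim: "(\<lambda>k. oproj T (y k)) \<longlonglongrightarrow> oproj T x0"
    by (rule bounded_linear.tendsto[OF bounded_linear_oproj y_lim])
  have tV: "\<forall>\<^sub>F k in sequentially. oproj T (y k) \<in> V"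
  proof -
    obtain V' where V': "open V'" "V = T \<inter> V'" using V by (meson openin_open)
    then have "\<forall>\<^sub>F k in sequentially. oproj T (y k) \<in> V'"
      using t_lim \<Xi>(2) by (auto intro: topological_tendstoD)
    then show ?thesis by (rule eventually_mono) (use V' oproj_in[OF T(1)] in auto)
  qed
  have \<Xi>0: "\<Xi> (oproj T x0) = x0" using \<Xi>(4) x0 Q by auto
  have m_lim: "m \<longlonglongrightarrow> x0"
    using continuous_on_tendsto_compose[OF Ck_on_continuous[OF \<Xi>(1)] t_lim \<Xi>(2) tV]
    by (simp add: m_def \<Xi>0)
  define e where "e = (\<lambda>k. (y k - m k) /\<^sub>R norm (y k - m k))"
  have eN: "(y k - m k) \<in> {n \<in> X. \<forall>t\<in>T. n \<bullet> t = 0}" "norm (e k) = 1" "m k \<in> M"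
    if k: "oproj T (y k) \<in> V" for k
  proof -
    show mM: "m k \<in> M" using \<Xi>(3) k by (simp add: m_def)
    have "(y k - m k) \<bullet> t = oproj T (y k) \<bullet> t - oproj T (m k) \<bullet> t" if "t \<in> T" for t
      using oproj_inner[OF T(1) that] by (simp add: inner_diff_left)
    moreover have "oproj T (m k) = oproj T (y k)" using \<Xi>(3) k by (simp add: m_def)
    ultimately show "(y k - m k) \<in> {n \<in> X. \<forall>t\<in>T. n \<bullet> t = 0}"
      using yX mM MX X by (auto intro!: subspace_diff)
    have "y k \<noteq> m k" using mM u(3)[of k] by (auto simp: y_def)
    then show "norm (e k) = 1" by (simp add: e_def)
  qed
  have "\<forall>\<^sub>F k in sequentially. e k \<in> sphere 0 1" using tV by eventually_elim (simp add: eN(2))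
  then obtain K where K: "\<And>k. k \<ge> K \<Longrightarrow> e k \<in> sphere 0 1" by (auto simp: eventually_sequentially)
  then have "\<forall>k. (\<lambda>k. e (k + K)) k \<in> sphere 0 1" by simp
  then obtain e0 s where e0: "e0 \<in> sphere 0 1" and s: "strict_mono (s :: nat \<Rightarrow> nat)"
    "((\<lambda>k. e (k + K)) \<circ> s) \<longlonglongrightarrow> e0"
    using compact_sphere[of 0 1, unfolded compact_def, rule_format, of "\<lambda>k. e (k + K)"] by metis
  have seq: "filterlim (\<lambda>k. s k + K) sequentially sequentially"
    using filterlim_compose[OF filterlim_add_const_nat_at_top filterlim_subseq[OF s(1)]] .
  define N where "N = {n \<in> X. \<forall>t\<in>T. n \<bullet> t = 0}"
  have "subspace N" using X by (auto simp: N_def subspace_def inner_add_left)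
  have "e0 \<in> N"
  proof (rule Lim_in_closed_set[OF closed_subspace[OF \<open>subspace N\<close>] _ _ s(2)])
    have "\<forall>\<^sub>F k in sequentially. e k \<in> N"
      using tV
    proof eventually_elim
      case (elim k)
      then show ?case using eN(1)[OF elim] \<open>subspace N\<close>
        unfolding e_def N_def[symmetric] by (rule_tac subspace_scale)
    qed
    then show "\<forall>\<^sub>F k in sequentially. ((\<lambda>k. e (k + K)) \<circ> s) k \<in> N"
      using eventually_compose_filterlim[OF _ seq] by simp
  qed simp
  then have "e0 \<in> parallel_subspace (subdiff X h x0)" using N par by (auto simp: N_def)
  note ri = rel_interior_perturb[OF v0 this]
  have "((\<lambda>\<delta>. v0 + \<delta> *\<^sub>R e0) \<longlongrightarrow> v0 + 0 *\<^sub>R e0) (at_right 0)" by (intro tendsto_intros)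
  then have "\<forall>\<^sub>F \<delta> in at_right 0. v0 + \<delta> *\<^sub>R e0 \<in> S"
    by (rule topological_tendstoD) (use assms in auto)
  with ri have "\<forall>\<^sub>F \<delta> in at_right (0::real). v0 + \<delta> *\<^sub>R e0 \<in> S \<inter> subdiff X h x0 \<and> \<delta> > 0"
    using eventually_at_right_less[of "0::real"] by eventually_elim auto
  then obtain \<delta> where \<delta>: "v0 + \<delta> *\<^sub>R e0 \<in> S \<inter> subdiff X h x0" "\<delta> > 0"
    using eventually_happens by (metis (no_types, lifting) trivial_limit_at_right_real)
  define w0 where "w0 = v0 + \<delta> *\<^sub>R e0"
  have "\<forall>\<^sub>F y in at x0 within M. \<exists>w\<in>S \<inter> subdiff X h y. dist w w0 < \<delta> / 4"
    using assms(7)[unfolded inner_semicontinuous_at_def, rule_format, OF \<delta>(1), of "\<delta> / 4"] \<delta>(2)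
    unfolding w0_def by simp
  moreover have "\<exists>w\<in>S \<inter> subdiff X h x0. dist w w0 < \<delta> / 4"
    using \<delta> by (intro bexI[of _ w0]) (auto simp: w0_def)
  ultimately have "\<forall>\<^sub>F y in nhds x0. y \<in> M \<longrightarrow> (\<exists>w\<in>S \<inter> subdiff X h y. dist w w0 < \<delta> / 4)"
    unfolding eventually_at_filter by (auto elim: eventually_mono)
  then have "\<forall>\<^sub>F k in sequentially. m k \<in> M \<longrightarrow> (\<exists>w\<in>S \<inter> subdiff X h (m k). dist w w0 < \<delta> / 4)"
    using m_lim by (rule eventually_compose_filterlim)
  moreover have "\<forall>\<^sub>F k in sequentially. dist (\<sigma> *\<^sub>R (u k - y k)) v0 < \<delta> / 4"
  proof (rule tendstoD)
    have "(\<lambda>k. \<sigma> *\<^sub>R (u k - y k)) \<longlonglongrightarrow> \<sigma> *\<^sub>R (u0 - x0)" by (intro tendsto_intros u_lim y_lim)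
    then show "(\<lambda>k. \<sigma> *\<^sub>R (u k - y k)) \<longlonglongrightarrow> v0" using \<sigma> by (simp add: u0_def)
  qed (use \<delta> in simp)
  ultimately have "\<forall>\<^sub>F k in sequentially. oproj T (y k) \<in> V \<and>
      (\<exists>w\<in>subdiff X h (m k). dist w w0 < \<delta> / 4) \<and> dist (\<sigma> *\<^sub>R (u k - y k)) v0 < \<delta> / 4"
    using tV by eventually_elim (use eN(3) in blast)
  then have ev1: "\<forall>\<^sub>F k in sequentially. oproj T (y (s k + K)) \<in> V \<and>
      (\<exists>w\<in>subdiff X h (m (s k + K)). dist w w0 < \<delta> / 4) \<and>
      dist (\<sigma> *\<^sub>R (u (s k + K) - y (s k + K))) v0 < \<delta> / 4"
    using seq by (rule eventually_compose_filterlim)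
  have "\<forall>\<^sub>F k in sequentially. dist (e (s k + K)) e0 < 1 / 4"
    using tendstoD[OF s(2), of "1/4"] by simp
  with ev1 have "\<forall>\<^sub>F k in sequentially. oproj T (y (s k + K)) \<in> V \<and>
      (\<exists>w\<in>subdiff X h (m (s k + K)). dist w w0 < \<delta> / 4) \<and>
      dist (\<sigma> *\<^sub>R (u (s k + K) - y (s k + K))) v0 < \<delta> / 4 \<and> dist (e (s k + K)) e0 < 1 / 4"
    by eventually_elim blast
  then obtain k where "oproj T (y (s k + K)) \<in> V \<and>
      (\<exists>w\<in>subdiff X h (m (s k + K)). dist w w0 < \<delta> / 4) \<and>
      dist (\<sigma> *\<^sub>R (u (s k + K) - y (s k + K))) v0 < \<delta> / 4 \<and> dist (e (s k + K)) e0 < 1 / 4"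
    using eventually_happens'[OF sequentially_bot] by blast
  then obtain j w where tj: "oproj T (y j) \<in> V" and w: "w \<in> subdiff X h (m j)" "norm (w - w0) < \<delta> / 4"
    and vj: "norm (\<sigma> *\<^sub>R (u j - y j) - v0) < \<delta> / 4" and ej: "norm (e j - e0) < 1 / 4"
    unfolding dist_norm by blast
  define a where "a = (\<sigma> *\<^sub>R (u j - y j) - v0) - (w - w0)"
  have ej1: "norm (e j) = 1" using eN(2)[OF tj] .
  have "0 \<le> (\<sigma> *\<^sub>R (u j - y j) - w) \<bullet> (y j - m j)"
    using subdiff_monotone[OF _ w(1)] prox_subgradient[OF u(1)[of j]] by (simp add: y_def)
  then have "0 \<le> (\<sigma> *\<^sub>R (u j - y j) - w) \<bullet> e j"
    by (simp add: e_def inner_scaleR_right)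
  also have "\<sigma> *\<^sub>R (u j - y j) - w = a - \<delta> *\<^sub>R e0" by (simp add: a_def w0_def)
  finally have "0 \<le> a \<bullet> e j - \<delta> * (e0 \<bullet> e j)" by (simp add: inner_diff_left)
  moreover have "a \<bullet> e j < \<delta> / 2"
  proof -
    have "a \<bullet> e j \<le> norm a" using norm_cauchy_schwarz[of a "e j"] ej1 by simp
    also have "norm a < \<delta> / 2"
      using w(2) vj norm_triangle_ineq4[of "\<sigma> *\<^sub>R (u j - y j) - v0" "w - w0"] by (simp add: a_def)
    finally show ?thesis .
  qed
  moreover have "e0 \<bullet> e j > 3 / 4"
  proof -
    have "e0 \<bullet> e j = e0 \<bullet> e0 + e0 \<bullet> (e j - e0)" by (simp add: inner_diff_right)
    moreover have "\<bar>e0 \<bullet> (e j - e0)\<bar> < 1 / 4"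
      using Cauchy_Schwarz_ineq2[of e0 "e j - e0"] e0 ej by simp
    moreover have "e0 \<bullet> e0 = 1" using e0 by (simp add: norm_eq_1)
    ultimately show ?thesis by linarith
  qed
  ultimately have "\<delta> * (3 / 4) < \<delta> / 2"
    using \<delta>(2) mult_strict_left_mono[of "3/4" "e0 \<bullet> e j" \<delta>] by linarith
  then show False using \<delta>(2) by simp
qed

lemma prox_Ck_on_manifold:
  assumes emb: "embedded_submanifold (Suc q) X M" and x0: "x0 \<in> M" and u0: "u0 \<in> X" "P u0 = x0"
    and W: "openin (top_of_set X) W" "u0 \<in> W" "\<And>u. u \<in> W \<Longrightarrow> P u \<in> M"
    and g: "openin (top_of_set X) U2" "x0 \<in> U2" "Ck_on (Suc q) X U2 g"
      "\<And>y. y \<in> M \<inter> U2 \<Longrightarrow> h y = ereal (g y)"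
  shows "\<exists>U. openin (top_of_set X) U \<and> u0 \<in> U \<and> Ck_on q X U P"
proof -
  obtain T Q V \<Xi> where T: "subspace T" "T \<subseteq> X"
    and Q: "openin (top_of_set X) Q" "x0 \<in> Q" and V: "openin (top_of_set T) V"
    and \<Xi>: "Ck_on (Suc q) T V \<Xi>" "oproj T x0 \<in> V" "\<forall>t\<in>V. \<Xi> t \<in> M \<and> oproj T (\<Xi> t) = t"
      "\<forall>y\<in>M \<inter> Q. oproj T y \<in> V \<and> \<Xi> (oproj T y) = y"
    by (rule graph_chart[OF X emb x0])
  have MX: "M \<subseteq> X" using emb by (simp add: embedded_submanifold_def)
  define V2 where "V2 = V \<inter> \<Xi> -` U2"
  have V2: "openin (top_of_set T) V2"
  proof -
    have "openin (top_of_set V) V2"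
      using continuous_openin_preimage[OF Ck_on_continuous[OF \<Xi>(1)] _ g(1)] \<Xi>(3) MX
      by (auto simp: V2_def)
    then show ?thesis using V openin_trans by blast
  qed
  have V2': "t \<in> V" "\<Xi> t \<in> U2" "\<Xi> t \<in> M" "\<Xi> t \<in> X" "oproj T (\<Xi> t) = t" "h (\<Xi> t) = ereal (g (\<Xi> t))"
    if "t \<in> V2" for t
    using that \<Xi>(3) MX g(4) by (auto simp: V2_def)
  have V2T: "V2 \<subseteq> T" using V2 openin_subset by force
  define U where "U = W \<inter> (X \<inter> P -` (Q \<inter> U2))"
  have "openin (top_of_set X) (X \<inter> P -` (Q \<inter> U2))"
    by (rule continuous_openin_preimage[OF prox_continuous _ openin_Int[OF Q(1) g(1)]])
      (use prox_in in auto)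
  then have U: "openin (top_of_set X) U" using W by (auto simp: U_def)
  have u0U: "u0 \<in> U" using u0 W Q g by (simp add: U_def)
  have UX: "U \<subseteq> X" by (auto simp: U_def)
  define \<tau> where "\<tau> = (\<lambda>u. oproj T (P u))"
  have \<tau>: "\<tau> u \<in> V2" "\<Xi> (\<tau> u) = P u" if "u \<in> U" for u
    using that W(3) \<Xi>(4) by (auto simp: U_def \<tau>_def V2_def)
  define \<gamma> where "\<gamma> = (\<lambda>w. g (\<Xi> (fst w)) + \<sigma> / 2 * ((\<Xi> (fst w) - snd w) \<bullet> (\<Xi> (fst w) - snd w)))"
  have TX: "subspace (T \<times> X)" using T X by (simp add: subspace_Times)
  have V2X: "openin (top_of_set (T \<times> X)) (V2 \<times> X)" using V2 by (simp add: openin_Times)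
  have "Ck_on (Suc q) (T \<times> X) (V2 \<times> X) \<gamma>"
  proof -
    have fst: "Ck_on (Suc q) (T \<times> X) (V2 \<times> X) fst" and snd: "Ck_on (Suc q) (T \<times> X) (V2 \<times> X) snd"
      by (simp_all only: Ck_on_bounded_linear bounded_linear_fst bounded_linear_snd)
    have \<Xi>V2: "Ck_on (Suc q) T V2 \<Xi>" by (rule Ck_on_subset[OF \<Xi>(1)]) (simp add: V2_def)
    have 1: "Ck_on (Suc q) (T \<times> X) (V2 \<times> X) (\<lambda>w. \<Xi> (fst w))"
      by (rule Ck_on_compose[OF TX V2X T(1) _ V2T fst \<Xi>V2]) auto
    have 2: "Ck_on (Suc q) (T \<times> X) (V2 \<times> X) (\<lambda>w. g (\<Xi> (fst w)))"
      by (rule Ck_on_compose[OF TX V2X X _ _ 1 g(3)]) (use V2'(2) g(1) openin_subset in force)+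
    have "Ck_on (Suc q) (T \<times> X) (V2 \<times> X) (\<lambda>w. g (\<Xi> (fst w))
        + (\<sigma> / 2) *\<^sub>R ((\<Xi> (fst w) - snd w) \<bullet> (\<Xi> (fst w) - snd w)))"
      by (intro Ck_on_add Ck_on_scaleR Ck_on_const Ck_on_inner Ck_on_diff 1 2 snd)
    then show ?thesis by (simp add: \<gamma>_def)
  qed
  then obtain \<gamma>' where \<gamma>': "\<And>w. w \<in> V2 \<times> X \<Longrightarrow> (\<gamma> has_derivative \<gamma>' w) (at w within V2 \<times> X)"
    "\<And>v. v \<in> T \<times> X \<Longrightarrow> Ck_on q (T \<times> X) (V2 \<times> X) (\<lambda>w. \<gamma>' w v)"
    unfolding Ck_on.simps by blast
  have growth: "\<gamma> (t, u) \<ge> \<gamma> (\<tau> u, u) + \<sigma> / 2 * (norm (t - \<tau> u))\<^sup>2" if "t \<in> V2" "u \<in> U" for t u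
  proof -
    have uX: "u \<in> X" using that UX by blast
    note p = prox_growth[OF uX V2'(4)[OF that(1)] V2'(6)[OF that(1)]]
    have "norm (t - \<tau> u) = norm (oproj T (\<Xi> t - P u))"
      using V2'(5)[OF that(1)] by (simp add: \<tau>_def linear_diff[OF linear_oproj])
    also have "\<dots> \<le> norm (\<Xi> t - P u)" by (rule norm_oproj_le[OF T(1)])
    finally have "\<sigma> / 2 * (norm (t - \<tau> u))\<^sup>2 \<le> \<sigma> / 2 * (norm (\<Xi> t - P u))\<^sup>2"
      using \<sigma> by (intro mult_left_mono power_mono) auto
    moreover have "real_of_ereal (h (P u)) = g (\<Xi> (\<tau> u))"
      using V2'(6)[OF \<tau>(1)[OF that(2)]] \<tau>(2)[OF that(2)] by simp
    ultimately show ?thesis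
      using p \<tau>(2)[OF that(2)] by (simp add: \<gamma>_def power2_norm_eq_inner)
  qed
  have dir: "((\<lambda>r. \<gamma> (t + r *\<^sub>R e, u)) has_vector_derivative \<gamma>' (t, u) (e, 0)) (at 0)"
    if "t \<in> V2" "u \<in> X" "e \<in> T" for t u e
    using has_derivative_directional[OF \<gamma>'(1) V2X TX, of "(t, u)" "(e, 0)"] that X
    by (simp add: subspace_0)
  have stationary: "\<gamma>' (\<tau> u, u) (e, 0) = 0" if u: "u \<in> U" and e: "e \<in> T" for u e
  proof -
    obtain d where d: "d > 0" "\<And>r. \<bar>r\<bar> < d \<Longrightarrow> \<tau> u + r *\<^sub>R e \<in> V2"
      using openin_segment[OF V2 T(1) \<tau>(1)[OF u] e] by metis
    have "((\<lambda>r. \<gamma> (\<tau> u + r *\<^sub>R e, u)) has_derivative (\<lambda>r. r *\<^sub>R \<gamma>' (\<tau> u, u) (e, 0))) (at 0)"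
      using dir[OF \<tau>(1)[OF u] _ e] UX u by (auto simp: has_vector_derivative_def)
    moreover have "\<forall>\<^sub>F r in at 0. \<gamma> (\<tau> u + 0 *\<^sub>R e, u) \<le> \<gamma> (\<tau> u + r *\<^sub>R e, u)"
      unfolding eventually_at
    proof (intro exI[of _ d] conjI ballI impI d(1))
      fix r :: real assume r: "r \<noteq> 0 \<and> dist r 0 < d"
      have "0 \<le> \<sigma> / 2 * (norm (r *\<^sub>R e))\<^sup>2" using \<sigma> by simp
      then show "\<gamma> (\<tau> u + 0 *\<^sub>R e, u) \<le> \<gamma> (\<tau> u + r *\<^sub>R e, u)"
        using growth[OF d(2)[of r] u] r by simp
    qed
    ultimately have "(\<lambda>r. r *\<^sub>R \<gamma>' (\<tau> u, u) (e, 0)) = (\<lambda>r. 0)" by (rule has_derivative_local_min)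
    from fun_cong[OF this, of 1] show ?thesis by simp
  qed
  define K where "K = (\<lambda>w. \<Sum>e\<in>onb T. \<gamma>' w (e, 0) *\<^sub>R e)"
  have K_inner: "K w \<bullet> y = \<gamma>' w (y, 0)" if w: "w \<in> V2 \<times> X" and y: "y \<in> T" for w y
  proof -
    interpret L: bounded_linear "\<gamma>' w" using \<gamma>'(1)[OF w] by (rule has_derivative_bounded_linear)
    have "linear (\<lambda>y. \<gamma>' w (y, 0))"
    proof (rule linearI)
      show "\<gamma>' w (r *\<^sub>R a, 0) = r *\<^sub>R \<gamma>' w (a, 0)" for r a
        using L.scaleR[of r "(a, 0)"] by simp
    qed (simp add: L.add[symmetric])
    from linear_onb_expand[OF T(1) this y] show ?thesis
      by (simp add: K_def inner_commute[of _ y] inner_sum_right mult.commute)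
  qed
  have "Ck_on q X U \<tau>"
  proof (rule Ck_on_implicit[OF X U T(1) _ _ V2X, where K = K])
    show "continuous_on U \<tau>" unfolding \<tau>_def
      by (rule continuous_on_compose2[OF linear_continuous_on[OF bounded_linear_oproj]
            continuous_on_subset[OF prox_continuous UX]]) auto
    show "\<tau> u \<in> T" for u by (simp add: \<tau>_def oproj_in[OF T(1)])
    show "(\<tau> u, u) \<in> V2 \<times> X" if "u \<in> U" for u using \<tau>(1) that UX by auto
    show "Ck_on q (T \<times> X) (V2 \<times> X) K"
      unfolding K_def using onb_subset[OF T(1)] X
      by (intro Ck_on_sum Ck_on_scaleR Ck_on_const \<gamma>'(2)) (auto simp: subspace_0)
    show "K (\<tau> u, u) = 0" if "u \<in> U" for u
      unfolding K_def using stationary[OF that] onb_subset[OF T(1)]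
      by (intro sum.neutral) auto
    fix u D y
    assume u: "u \<in> U" and D: "(K has_derivative D) (at (\<tau> u, u) within V2 \<times> X)"
      and y: "y \<in> T" and D0: "D (y, 0) = 0"
    have uX: "u \<in> X" using u UX by blast
    obtain d where d: "d > 0" "\<And>r. \<bar>r\<bar> < d \<Longrightarrow> \<tau> u + r *\<^sub>R y \<in> V2"
      using openin_segment[OF V2 T(1) \<tau>(1)[OF u] y] by metis
    define \<psi> where "\<psi> = (\<lambda>r. \<gamma> (\<tau> u + r *\<^sub>R y, u))"
    define \<phi> where "\<phi> = (\<lambda>r. K (\<tau> u + r *\<^sub>R y, u) \<bullet> y)"
    have "\<sigma> / 2 * (norm y)\<^sup>2 \<le> 0"
    proof (rule no_quadratic_growth[OF d(1), of \<psi> \<phi>])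
      fix r :: real assume r: "\<bar>r\<bar> < d"
      have "((\<lambda>s. \<gamma> ((\<tau> u + r *\<^sub>R y) + s *\<^sub>R y, u)) has_vector_derivative \<phi> r) (at 0)"
        using dir[OF d(2)[OF r] uX y] K_inner[of "(\<tau> u + r *\<^sub>R y, u)" y] d(2)[OF r] uX y
        by (simp add: \<phi>_def)
      then have "((\<lambda>s. \<psi> (s + r)) has_real_derivative \<phi> r) (at 0)"
        by (simp add: \<psi>_def has_real_derivative_iff_has_vector_derivative algebra_simps)
      then show "(\<psi> has_real_derivative \<phi> r) (at r)"
        using DERIV_shift[of \<psi> "\<phi> r" 0 r] by simp
      show "\<psi> r \<ge> \<psi> 0 + \<sigma> / 2 * (norm y)\<^sup>2 * r\<^sup>2"
        using growth[OF d(2)[OF r] u] by (simp add: \<psi>_def power_mult_distrib mult_ac)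
    next
      have "((\<lambda>r. K ((\<tau> u, u) + r *\<^sub>R (y, 0))) has_vector_derivative D (y, 0)) (at 0)"
        by (rule has_derivative_directional[OF D V2X TX]) (use \<tau>(1)[OF u] uX y X in \<open>auto simp: subspace_0\<close>)
      then have "((\<lambda>r. K (\<tau> u + r *\<^sub>R y, u)) has_derivative (\<lambda>r. 0)) (at 0)"
        by (simp add: has_vector_derivative_def D0)
      then have "(\<phi> has_derivative (\<lambda>r. 0 \<bullet> y)) (at 0)"
        unfolding \<phi>_def by (rule has_derivative_inner_left)
      then show "(\<phi> has_real_derivative 0) (at 0)"
        by (simp add: has_field_derivative_def lambda_zero)
      have "\<phi> 0 = \<gamma>' (\<tau> u, u) (y, 0)"
        using K_inner[of "(\<tau> u, u)" y] \<tau>(1)[OF u] uX y by (simp add: \<phi>_def)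
      then show "\<phi> 0 = 0" using stationary[OF u y] by simp
    qed
    then show "y = 0" using \<sigma> by (simp add: mult_le_0_iff)
  qed
  have "Ck_on q T V2 \<Xi>"
    by (rule Ck_on_subset[OF Ck_on_SucD[OF \<Xi>(1)]]) (simp add: V2_def)
  with \<open>Ck_on q X U \<tau>\<close> have "Ck_on q X U (\<lambda>u. \<Xi> (\<tau> u))"
    by (rule Ck_on_compose[OF X U T(1) _ V2T, rotated]) (use \<tau>(1) in auto)
  then have "Ck_on q X U P" using Ck_on_cong[of U "\<lambda>u. \<Xi> (\<tau> u)" P] \<tau>(2) by blast
  then show ?thesis using U u0U by blast
qed

end

theorem moreau_env_smooth:
  assumes X: "subspace X" and \<sigma>: "\<sigma> > 0" and ps: "partly_smooth (Suc q) X h M x0 v0"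
    and ri: "v0 \<in> rel_interior (subdiff X h x0)"
  shows "\<exists>U. openin (top_of_set X) U \<and> x0 + v0 /\<^sub>R \<sigma> \<in> U \<and> Ck_on (Suc q) X U (moreau_env \<sigma> X h)"
proof -
  have v0: "v0 \<in> subdiff X h x0" using ri rel_interior_subset by blast
  interpret moreau X h \<sigma>
    using X \<sigma> ps v0 by unfold_locales (auto simp: partly_smooth_def)
  define u0 where "u0 = x0 + v0 /\<^sub>R \<sigma>"
  have u0: "u0 \<in> X"
    using subdiff_real(2,3)[OF v0] X by (simp add: u0_def subspace_add subspace_scale)
  have Pu0: "P u0 = x0" using \<sigma> v0 by (intro prox_unique[OF u0]) (simp add: u0_def)
  have emb: "embedded_submanifold (Suc q) X M" and x0: "x0 \<in> M"
    and par: "parallel_subspace (subdiff X h x0) = normal_space X M x0"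
    using ps by (auto simp: partly_smooth_def)
  obtain S where S: "open S" "v0 \<in> S" "inner_semicontinuous_at (\<lambda>y. S \<inter> subdiff X h y) x0 M"
    using ps by (auto simp: partly_smooth_def)
  obtain U2 and g :: "'a \<Rightarrow> real" where g: "openin (top_of_set X) U2" "x0 \<in> U2" "Ck_on (Suc q) X U2 g"
    "\<forall>y\<in>M \<inter> U2. h y = ereal (g y)"
    using ps unfolding partly_smooth_def by blast
  obtain d where d: "d > 0" "\<forall>u\<in>X. dist u u0 < d \<longrightarrow> P u \<in> M"
    using prox_identifies_manifold[OF ri emb x0 par S] unfolding u0_def by blast
  have "openin (top_of_set X) (X \<inter> ball u0 d)" by (auto simp: openin_open)
  then obtain U where U: "openin (top_of_set X) U" "u0 \<in> U" "Ck_on q X U P"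
    using prox_Ck_on_manifold[OF emb x0 u0 Pu0, of "X \<inter> ball u0 d" U2 g] d g u0
    by (auto simp: dist_commute)
  then have "Ck_on (Suc q) X U (moreau_env \<sigma> X h)"
    by (intro Ck_on_moreau_env) (use openin_subset in force)+
  then show ?thesis using U by (auto simp: u0_def)
qed


section \<open>Local smoothness\<close>

definition Ck_near :: "nat \<Rightarrow> 'a::real_normed_vector set \<Rightarrow> 'a \<Rightarrow> ('a \<Rightarrow> 'b::real_normed_vector) \<Rightarrow> bool" where
  "Ck_near k X a f \<longleftrightarrow> (\<exists>U. openin (top_of_set X) U \<and> a \<in> U \<and> Ck_on k X U f)"

lemma Ck_near_add:
  assumes "Ck_near k X a f" "Ck_near k X a g"
  shows "Ck_near k X a (\<lambda>x. f x + g x)"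
proof -
  obtain U V where "openin (top_of_set X) U" "a \<in> U" "Ck_on k X U f"
    "openin (top_of_set X) V" "a \<in> V" "Ck_on k X V g"
    using assms by (auto simp: Ck_near_def)
  then show ?thesis unfolding Ck_near_def
    by (intro exI[of _ "U \<inter> V"]) (auto intro: Ck_on_add Ck_on_subset)
qed

lemma Ck_near_Ck_on: "Ck_on k X X f \<Longrightarrow> a \<in> X \<Longrightarrow> Ck_near k X a f"
  unfolding Ck_near_def by (intro exI[of _ X]) auto

lemma Ck_near_sum:
  assumes "a \<in> X" "\<And>i. i \<in> I \<Longrightarrow> Ck_near k X a (f i)"
  shows "Ck_near k X a (\<lambda>x. \<Sum>i\<in>I. f i x)"
  using assms(2)
  by (induction I rule: infinite_finite_induct)
    (auto intro: Ck_near_Ck_on[OF Ck_on_zero assms(1)] Ck_near_add)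

lemma Ck_near_compose:
  fixes l :: "'a::real_normed_vector \<Rightarrow> 'b::euclidean_space"
  assumes "subspace X" "subspace Y" "Ck_on k X X l" "l ` X \<subseteq> Y" "a \<in> X" "Ck_near k Y (l a) g"
  shows "Ck_near k X a (\<lambda>x. g (l x))"
proof -
  obtain V where V: "openin (top_of_set Y) V" "l a \<in> V" "Ck_on k Y V g"
    using assms(6) by (auto simp: Ck_near_def)
  define U where "U = X \<inter> l -` V"
  have U: "openin (top_of_set X) U"
    unfolding U_def
    by (rule continuous_openin_preimage[OF Ck_on_continuous[OF assms(3)] _ V(1)]) (use assms(4) in auto)
  have "Ck_on k X U (\<lambda>x. g (l x))"
  proof (rule Ck_on_compose[OF assms(1) U assms(2) _ _ _ V(3)])
    show "Ck_on k X U l" by (rule Ck_on_subset[OF assms(3)]) (simp add: U_def)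
    show "V \<subseteq> Y" using V(1) openin_subset by force
  qed (auto simp: U_def)
  then show ?thesis using U V(2) assms(5) by (auto simp: Ck_near_def U_def)
qed


section \<open>Gradients\<close>

lemma has_derivative_cong_on_subspace:
  assumes "(f has_derivative D) (at x within X)" "subspace X" "x \<in> X"
    and "bounded_linear D'" "\<And>v. v \<in> X \<Longrightarrow> D' v = D v"
  shows "(f has_derivative D') (at x within X)"
proof -
  have "D' (y - x) = D (y - x)" if "y \<in> X" for y
    using assms that by (simp add: subspace_diff)
  with assms(1,4) show ?thesis
    unfolding has_derivative_within_alt by (metis (no_types, lifting))
qed

lemma grad_on_eq:
  assumes X: "subspace X" "x \<in> X" and D: "(f has_derivative D) (at x within X)"
  shows "grad_on X f x = (\<Sum>e\<in>onb X. D e *\<^sub>R e)"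
proof -
  interpret D: bounded_linear D using D by (rule has_derivative_bounded_linear)
  define g where "g = (\<Sum>e\<in>onb X. D e *\<^sub>R e)"
  have gX: "g \<in> X"
    unfolding g_def using X onb_subset by (intro subspace_sum subspace_scale) auto
  have gD: "g \<bullet> v = D v" if "v \<in> X" for v
    using linear_onb_expand[OF X(1) D.linear_axioms that]
    by (simp add: g_def inner_commute[of _ v] inner_sum_right mult.commute)
  have g: "(f has_derivative (\<lambda>v. g \<bullet> v)) (at x within X)"
    by (rule has_derivative_cong_on_subspace[OF D X bounded_linear_inner_right gD])
  have "y = g" if y: "y \<in> X" "(f has_derivative (\<lambda>v. y \<bullet> v)) (at x within X)" for y
  proof -
    have "y \<bullet> v = g \<bullet> v" if "v \<in> X" for v
      using has_derivative_unique_on_subspace[OF y(2) g openin_subtopology_self X that] .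
    moreover have "y - g \<in> X" using X y gX by (simp add: subspace_diff)
    ultimately have "(y - g) \<bullet> (y - g) = 0" by (simp add: inner_diff_left)
    then show "y = g" by simp
  qed
  then show ?thesis
    unfolding grad_on_def g_def[symmetric] using g gX by (rule_tac the_equality) blast+
qed

lemma Ck_near_partial_gradients:
  fixes \<Psi> :: "'a::euclidean_space \<Rightarrow> 'b::euclidean_space \<Rightarrow> real"
  assumes A: "subspace A" and B: "subspace B"
    and \<Psi>: "Ck_near (Suc q) (A \<times> B) w0 (\<lambda>w. \<Psi> (fst w) (snd w))"
  shows "Ck_near q (A \<times> B) w0 (\<lambda>(x, z). (grad_on A (\<lambda>x'. \<Psi> x' z) x, - grad_on B (\<lambda>z'. \<Psi> x z') z))"
proof -
  obtain U where U: "openin (top_of_set (A \<times> B)) U" "w0 \<in> U"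
    and C: "Ck_on (Suc q) (A \<times> B) U (\<lambda>w. \<Psi> (fst w) (snd w))"
    using \<Psi> by (auto simp: Ck_near_def)
  obtain D where D: "\<And>w. w \<in> U \<Longrightarrow> ((\<lambda>w. \<Psi> (fst w) (snd w)) has_derivative D w) (at w within U)"
    "\<And>v. v \<in> A \<times> B \<Longrightarrow> Ck_on q (A \<times> B) U (\<lambda>w. D w v)"
    using C unfolding Ck_on.simps by blast
  obtain S where S: "open S" "U = (A \<times> B) \<inter> S" using U(1) by (meson openin_open)
  have gradA: "grad_on A (\<lambda>x'. \<Psi> x' z) x = (\<Sum>e\<in>onb A. D (x, z) (e, 0) *\<^sub>R e)" if xz: "(x, z) \<in> U" for x z
  proof (rule grad_on_eq[OF A])
    show x: "x \<in> A" using xz S by auto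
    define S' where "S' = (\<lambda>x'. (x', z)) -` S"
    have S': "open S'" unfolding S'_def
      by (rule open_vimage[OF S(1)]) (intro continuous_intros)
    have eq: "at x within A \<inter> S' = at x within A"
      by (rule at_within_nhd[of x S']) (use S' xz S in \<open>auto simp: S'_def\<close>)
    have "((\<lambda>x'. (x', z)) has_derivative (\<lambda>v. (v, 0))) (at x within A \<inter> S')"
      by (auto intro!: derivative_eq_intros)
    from has_derivative_in_compose2[of U _ D, OF D(1) _ _ this]
    have "((\<lambda>x'. \<Psi> (fst (x', z)) (snd (x', z))) has_derivative (\<lambda>v. D (x, z) (v, 0))) (at x within A \<inter> S')"
      using xz S by (auto simp: S'_def)
    then show "((\<lambda>x'. \<Psi> x' z) has_derivative (\<lambda>v. D (x, z) (v, 0))) (at x within A)"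
      by (simp add: eq)
  qed
  have gradB: "grad_on B (\<lambda>z'. \<Psi> x z') z = (\<Sum>e\<in>onb B. D (x, z) (0, e) *\<^sub>R e)" if xz: "(x, z) \<in> U" for x z
  proof (rule grad_on_eq[OF B])
    show z: "z \<in> B" using xz S by auto
    define S' where "S' = Pair x -` S"
    have S': "open S'" unfolding S'_def
      by (rule open_vimage[OF S(1)]) (intro continuous_intros)
    have eq: "at z within B \<inter> S' = at z within B"
      by (rule at_within_nhd[of z S']) (use S' xz S in \<open>auto simp: S'_def\<close>)
    have "(Pair x has_derivative Pair 0) (at z within B \<inter> S')"
      by (auto intro!: derivative_eq_intros)
    from has_derivative_in_compose2[of U _ D, OF D(1) _ _ this]
    have "((\<lambda>z'. \<Psi> (fst (x, z')) (snd (x, z'))) has_derivative (\<lambda>v. D (x, z) (0, v))) (at z within B \<inter> S')"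
      using xz S by (auto simp: S'_def)
    then show "((\<lambda>z'. \<Psi> x z') has_derivative (\<lambda>v. D (x, z) (0, v))) (at z within B)"
      by (simp add: eq)
  qed
  have "Ck_on q (A \<times> B) U (\<lambda>w. (\<Sum>e\<in>onb A. D w (e, 0) *\<^sub>R e, - (\<Sum>e\<in>onb B. D w (0, e) *\<^sub>R e)))"
    using onb_subset[OF A] onb_subset[OF B] A B
    by (intro Ck_on_Pair Ck_on_minus Ck_on_sum Ck_on_scaleR Ck_on_const D(2)) (auto simp: subspace_0)
  then have "Ck_on q (A \<times> B) U (\<lambda>(x, z). (grad_on A (\<lambda>x'. \<Psi> x' z) x, - grad_on B (\<lambda>z'. \<Psi> x z') z))"
    by (subst Ck_on_cong) (auto simp: gradA gradB)
  then show ?thesis using U by (auto simp: Ck_near_def)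
qed


section \<open>Partly smooth functions that are differentiable\<close>

lemma subdiff_differentiable_unique:
  assumes X: "subspace X" and fin: "\<And>y. y \<in> X \<Longrightarrow> \<bar>h y\<bar> \<noteq> \<infinity>"
    and D: "((\<lambda>y. real_of_ereal (h y)) has_derivative D) (at x within X)"
    and v: "v \<in> subdiff X h x" and w: "w \<in> X"
  shows "v \<bullet> w = D w"
proof -
  have x: "x \<in> X" using subdiff_real(2)[OF v] .
  let ?f = "\<lambda>r. real_of_ereal (h (x + r *\<^sub>R w)) - r * (v \<bullet> w)"
  have "((\<lambda>r. real_of_ereal (h (x + r *\<^sub>R w))) has_vector_derivative D w) (at 0)"
    by (rule has_derivative_directional[OF D openin_subtopology_self X x w])
  then have "(?f has_derivative (\<lambda>r. r * (D w - v \<bullet> w))) (at 0)"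
    by (auto simp: has_vector_derivative_def right_diff_distrib intro!: derivative_eq_intros)
  moreover have "?f 0 \<le> ?f r" for r
  proof -
    have y: "x + r *\<^sub>R w \<in> X" using X x w by (simp add: subspace_add subspace_scale)
    have "h (x + r *\<^sub>R w) = ereal (real_of_ereal (h (x + r *\<^sub>R w)))"
      using fin[OF y] by (simp add: ereal_real')
    from subdiff_ineq[OF v y this] show ?thesis by simp
  qed
  then have "\<forall>\<^sub>F r in at 0. ?f 0 \<le> ?f r" by simp
  ultimately have "(\<lambda>r. r * (D w - v \<bullet> w)) = (\<lambda>r. 0)" by (rule has_derivative_local_min)
  from fun_cong[OF this, of 1] show ?thesis by simp
qed

lemma partly_smooth_differentiable:
  assumes X: "subspace X" and fin: "\<And>y. y \<in> X \<Longrightarrow> \<bar>h y\<bar> \<noteq> \<infinity>"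
    and D: "((\<lambda>y. real_of_ereal (h y)) has_derivative D) (at x within X)"
    and ps: "partly_smooth (Suc q) X h M x v"
  shows "Ck_near (Suc q) X x (\<lambda>y. real_of_ereal (h y))"
proof -
  have emb: "embedded_submanifold (Suc q) X M" and x: "x \<in> M"
    and par: "parallel_subspace (subdiff X h x) = normal_space X M x"
    using ps by (auto simp: partly_smooth_def)
  have "v1 = v2" if v: "v1 \<in> subdiff X h x" "v2 \<in> subdiff X h x" for v1 v2
  proof -
    have "v1 - v2 \<in> X" using v subdiff_real(3) X by (blast intro: subspace_diff)
    then have "(v1 - v2) \<bullet> (v1 - v2) = 0"
      using subdiff_differentiable_unique[OF X fin D] v by (simp add: inner_diff_left)
    then show ?thesis by simp
  qed
  then have "{u - v | u v. u \<in> subdiff X h x \<and> v \<in> subdiff X h x} \<subseteq> {0}" by auto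
  then have "parallel_subspace (subdiff X h x) \<subseteq> {0}"
    unfolding parallel_subspace_def by (rule span_minimal) (rule subspace_single_0)
  then have normal0: "normal_space X M x \<subseteq> {0}" using par by simp
  obtain T N U G G' where "subspace T" "T \<subseteq> X" "subspace N" and N: "N \<subseteq> normal_space X M x"
    and "N = {n \<in> X. \<forall>t\<in>T. n \<bullet> t = 0}" and U: "openin (top_of_set X) U" "x \<in> U"
    and "Ck_on (Suc q) X U G" and G: "G ` U \<subseteq> N" "M \<inter> U = {y \<in> U. G y = 0}"
    and "(G has_derivative G') (at x within U)" "\<forall>v\<in>X. G' v = v - oproj T v"
    by (rule normalized_equation[OF X emb x])
  have UM: "U \<subseteq> M" using G N normal0 by blast
  obtain U2 and g :: "'a \<Rightarrow> real" where g: "openin (top_of_set X) U2" "x \<in> U2" "Ck_on (Suc q) X U2 g"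
    "\<forall>y\<in>M \<inter> U2. h y = ereal (g y)"
    using ps unfolding partly_smooth_def by blast
  have "Ck_on (Suc q) X (U \<inter> U2) g" by (rule Ck_on_subset[OF g(3)]) auto
  moreover have "real_of_ereal (h y) = g y" if "y \<in> U \<inter> U2" for y
    using g(4) UM that by auto
  ultimately have "Ck_on (Suc q) X (U \<inter> U2) (\<lambda>y. real_of_ereal (h y))"
    using Ck_on_cong[of "U \<inter> U2" "\<lambda>y. real_of_ereal (h y)" g] by blast
  then show ?thesis
    unfolding Ck_near_def using U g(1,2) by (intro exI[of _ "U \<inter> U2"]) auto
qed


section \<open>The saddle function\<close>

lemma subspace_x_space: "(\<And>i. subspace (X i)) \<Longrightarrow> subspace (x_space X n)"
  by (auto simp: x_space_def subspace_def)

lemma subspace_z_space: "(\<And>i. subspace (X i)) \<Longrightarrow> subspace (z_space X I1)"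
  by (auto simp: z_space_def subspace_def)

theorem lemma4p4:
  fixes X :: "'n::finite \<Rightarrow> 'a::euclidean_space set"
    and A :: "'n \<Rightarrow> 'a \<Rightarrow> 'a"
    and b :: 'a
    and n :: 'n
    and I1 :: "'n set"
    and h :: "'n \<Rightarrow> 'a \<Rightarrow> ereal"
    and \<sigma> :: real
    and p :: nat
    and x z :: "'a ^ 'n"
  assumes index: "n \<notin> I1"
    and spaces: "\<And>i. subspace (X i)"
    and linear: "\<And>i. i \<noteq> n \<Longrightarrow> linear (A i)"
    and range: "\<And>i. i \<noteq> n \<Longrightarrow> A i ` X i \<subseteq> X n"
    and b: "b \<in> X n"
    and h1_real: "\<And>i y. i \<in> I1 \<Longrightarrow> y \<in> X i \<Longrightarrow> \<bar>h i y\<bar> \<noteq> \<infinity>"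
    and h1_convex: "\<And>i. i \<in> I1 \<Longrightarrow> convex_on (X i) (\<lambda>y. real_of_ereal (h i y))"
    and h1_C2: "\<And>i. i \<in> I1 \<Longrightarrow> Ck_on 2 (X i) (X i) (\<lambda>y. real_of_ereal (h i y))"
    and h1_Lipschitz: "\<And>i. i \<in> I1 \<Longrightarrow>
           \<exists>L. L-lipschitz_on (X i) (grad_on (X i) (\<lambda>y. real_of_ereal (h i y)))"
    and h2: "\<And>i. i \<notin> I1 \<Longrightarrow> proper_closed_convex (X i) (h i)"
    and sigma: "\<sigma> > 0"
    and solvable: "\<exists>u. optimal_solution X A b n h u"
    and Slater: "\<exists>u. (\<forall>i. u i \<in> rel_interior (effdom (X i) (h i))) \<and>
                    (\<Sum>i\<in>-{n}. A i (u i)) + u n = b"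
    and pair: "optimal_pair X A b n I1 h x z"
    and p: "p \<ge> 2"
    and smooth1: "\<And>i. i \<in> I1 \<Longrightarrow> \<exists>M. partly_smooth p (X i) (h i) M (x $ i)
                     (grad_on (X i) (\<lambda>y. real_of_ereal (h i y)) (x $ i))"
    and smooth2: "\<And>i. i \<notin> I1 \<Longrightarrow> \<exists>M. partly_smooth p (X i) (h i) M (full_primal A b n x i)
                     (- (z $ i))"
    and SC: "strict_complementarity X A b n I1 h x z"
  shows "\<exists>U. openin (top_of_set (x_space X n \<times> z_space X I1)) U \<and> (x, z) \<in> U \<and>
             Ck_on (p - 1) (x_space X n \<times> z_space X I1) U (F_map X A b n I1 h \<sigma>)"


proof -
  obtain q where q: "p = Suc q" using p by (cases p) auto
  let ?W = "x_space X n \<times> z_space X I1"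
  have sx: "subspace (x_space X n)" and sz: "subspace (z_space X I1)"
    using spaces by (auto intro: subspace_x_space subspace_z_space)
  then have sW: "subspace ?W" by (rule subspace_Times)
  have xz: "(x, z) \<in> ?W" using pair by (simp add: optimal_pair_def)
  have xX: "fst w $ i \<in> X i" if "w \<in> ?W" "i \<noteq> n" for w i
    using that by (auto simp: x_space_def)
  have zX: "snd w $ i \<in> X i" if "w \<in> ?W" "i \<notin> I1" for w i
    using that by (auto simp: z_space_def)
  have bl_x: "bounded_linear (\<lambda>w::('a ^ 'n) \<times> ('a ^ 'n). fst w $ i)"
    and bl_z: "bounded_linear (\<lambda>w::('a ^ 'n) \<times> ('a ^ 'n). snd w $ i)" for i
    by (intro bounded_linear_compose[OF bounded_linear_vec_nth] bounded_linear_fst bounded_linear_snd)+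
  have Cx: "Ck_on p ?W ?W (\<lambda>w. fst w $ i)" and Cz: "Ck_on p ?W ?W (\<lambda>w. snd w $ i)" for i
    using bl_x bl_z by (auto intro: Ck_on_bounded_linear)
  have CA: "Ck_on p ?W ?W (\<lambda>w. A i (fst w $ i))" if "i \<noteq> n" for i
    by (rule Ck_on_bounded_linear_compose[OF linear[OF that, unfolded linear_conv_bounded_linear] Cx])
  have env: "Ck_near p (X i) (full_primal A b n x i - z $ i /\<^sub>R \<sigma>) (moreau_env \<sigma> (X i) (h i))"
    if "i \<notin> I1" for i
  proof -
    obtain M where M: "partly_smooth (Suc q) (X i) (h i) M (full_primal A b n x i) (- (z $ i))"
      using smooth2[OF \<open>i \<notin> I1\<close>] q by auto
    have "- (z $ i) \<in> rel_interior (subdiff (X i) (h i) (full_primal A b n x i))"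
      using SC that by (simp add: strict_complementarity_def)
    from moreau_env_smooth[OF spaces sigma M this] show ?thesis
      unfolding Ck_near_def q by simp
  qed
  have "Ck_near p ?W (x, z) (\<lambda>w. Phi X A b n I1 h \<sigma> (fst w) (snd w))"
  proof -
    have 1: "Ck_near p ?W (x, z) (\<lambda>w. \<Sum>i\<in>I1. real_of_ereal (h i (fst w $ i)))"
    proof (rule Ck_near_sum[OF xz])
      fix i assume i: "i \<in> I1"
      then have "i \<noteq> n" using index by blast
      obtain M where M: "partly_smooth (Suc q) (X i) (h i) M (x $ i)
          (grad_on (X i) (\<lambda>y. real_of_ereal (h i y)) (x $ i))"
        using smooth1[OF i] q by auto
      have "x $ i \<in> X i" using xX[OF xz \<open>i \<noteq> n\<close>] by simp
      then obtain D where "((\<lambda>y. real_of_ereal (h i y)) has_derivative D) (at (x $ i) within X i)"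
        using h1_C2[OF i] unfolding numeral_2_eq_2 Ck_on.simps by blast
      from partly_smooth_differentiable[OF spaces h1_real[OF i] this M]
      have "Ck_near p (X i) (fst (x, z) $ i) (\<lambda>y. real_of_ereal (h i y))" by (simp add: q)
      then show "Ck_near p ?W (x, z) (\<lambda>w. real_of_ereal (h i (fst w $ i)))"
        using xX[OF _ \<open>i \<noteq> n\<close>] by (intro Ck_near_compose[OF sW spaces Cx _ xz]) auto
    qed
    have 2: "Ck_near p ?W (x, z)
        (\<lambda>w. \<Sum>i\<in>-I1 - {n}. moreau_env \<sigma> (X i) (h i) (fst w $ i - (snd w $ i) /\<^sub>R \<sigma>))"
    proof (rule Ck_near_sum[OF xz])
      fix i assume "i \<in> -I1 - {n}"
      then have i: "i \<notin> I1" "i \<noteq> n" by auto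
      have C: "Ck_on p ?W ?W (\<lambda>w. fst w $ i - (snd w $ i) /\<^sub>R \<sigma>)"
        by (intro Ck_on_diff Ck_on_scaleR Ck_on_const Cx Cz)
      show "Ck_near p ?W (x, z) (\<lambda>w. moreau_env \<sigma> (X i) (h i) (fst w $ i - (snd w $ i) /\<^sub>R \<sigma>))"
        by (rule Ck_near_compose[OF sW spaces C _ xz])
          (use xX[OF _ i(2)] zX[OF _ i(1)] spaces env[OF i(1)] i(2) in
            \<open>auto simp: full_primal_def intro!: subspace_diff subspace_scale\<close>)
    qed
    have 3: "Ck_near p ?W (x, z) (\<lambda>w. moreau_env \<sigma> (X n) (h n)
        (b - (snd w $ n) /\<^sub>R \<sigma> - (\<Sum>i\<in>-{n}. A i (fst w $ i))))"
    proof (rule Ck_near_compose[OF sW spaces _ _ xz])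
      show "Ck_on p ?W ?W (\<lambda>w. b - (snd w $ n) /\<^sub>R \<sigma> - (\<Sum>i\<in>-{n}. A i (fst w $ i)))"
        by (intro Ck_on_diff Ck_on_sum Ck_on_scaleR Ck_on_const Cz CA) auto
      have "A i (fst w $ i) \<in> X n" if "w \<in> ?W" "i \<noteq> n" for w i
        using range[OF that(2)] xX[OF that] by blast
      then show "(\<lambda>w. b - (snd w $ n) /\<^sub>R \<sigma> - (\<Sum>i\<in>-{n}. A i (fst w $ i))) ` ?W \<subseteq> X n"
        using b zX[OF _ index] spaces
        by (intro image_subsetI subspace_diff subspace_scale subspace_sum) auto
      have "b - (snd (x, z) $ n) /\<^sub>R \<sigma> - (\<Sum>i\<in>-{n}. A i (fst (x, z) $ i))
          = full_primal A b n x n - z $ n /\<^sub>R \<sigma>" by (simp add: full_primal_def)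
      then show "Ck_near p (X n) (b - (snd (x, z) $ n) /\<^sub>R \<sigma> - (\<Sum>i\<in>-{n}. A i (fst (x, z) $ i)))
          (moreau_env \<sigma> (X n) (h n))"
        by (simp only: env[OF index])
    qed
    have "Ck_on p ?W ?W (\<lambda>w. (- (1 / (2 * \<sigma>))) *\<^sub>R (\<Sum>i\<in>-I1. snd w $ i \<bullet> snd w $ i))"
      by (intro Ck_on_scaleR Ck_on_const Ck_on_sum Ck_on_inner Cz)
    from Ck_near_add[OF Ck_near_add[OF Ck_near_add[OF 1 2] 3] Ck_near_Ck_on[OF this xz]]
    show ?thesis by (simp add: Phi_def power2_norm_eq_inner)
  qed
  from Ck_near_partial_gradients[OF sx sz this[unfolded q]] show ?thesis
    unfolding Ck_near_def F_map_def q by simp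
qed

end
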